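(* For each integer $n\ge 2$, there exists a bounded pseudoconvex domain $D_n\subset\mathbb{C}^n$ that admits a non-empty $\partial D_n$-open set $\omega_n\subset\partial D_n$ that is locally separating at some point in it and such that $\lim_{D_n\ni z\to p}s_{D_n}(z)=0$ for each $p\in\omega_n$.
   Context: $B^n(a,r)$ denotes the open Euclidean ball in $\mathbb{C}^n$ with centre $a$ and radius $r$. Squeezing function: for a bounded domain $D\subset\mathbb{C}^n$ and $z\in D$, $$s_D(z):=\sup\{s_D(z;F)\mid F:D\to B^n(0,1)\text{ is a holomorphic embedding with }F(z)=0\},$$ where $s_D(z;F):=\sup\{r>0: B^n(0,r)\subset F(D)\}$. Locally separating: if $A$ is a nowhere dense subset of $\mathbb{C}^n$ and $q\in A$, then $A$ is locally separating at $q$ if there exists an open ball $B$ with centre $q$ such that $B\setminus A$ has more than one connected component. "$\partial D_n$-open" means open in the relative topology of $\partial D_n$. *)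

theory Defs
  imports "HOL-Analysis.Analysis"
begin

(* Complex n-space is the type complex^'n: its norm is the Euclidean one (so ball is the
   Euclidean ball) and *s is the complex scalar multiplication. *)

definition domain_in :: "(complex^'n) set \<Rightarrow> bool" where
  "domain_in D \<longleftrightarrow> open D \<and> connected D \<and> D \<noteq> {}"

definition complex_linear :: "(complex^'n \<Rightarrow> complex^'m) \<Rightarrow> bool" where
  "complex_linear L \<longleftrightarrow>
     (\<forall>x y. L (x + y) = L x + L y) \<and> (\<forall>c x. L (c *s x) = c *s L x)"

definition holomorphic_map_on :: "(complex^'n \<Rightarrow> complex^'m) \<Rightarrow> (complex^'n) set \<Rightarrow> bool" where
  "holomorphic_map_on F D \<longleftrightarrow>
     (\<forall>z\<in>D. \<exists>L. (F has_derivative L) (at z) \<and> complex_linear L)"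

(* Injective holomorphic immersion that is a homeomorphism onto its image. For maps between
   open sets of equal dimension every injective holomorphic map is of this kind. *)
definition holomorphic_embedding_on ::
    "(complex^'n \<Rightarrow> complex^'m) \<Rightarrow> (complex^'n) set \<Rightarrow> bool" where
  "holomorphic_embedding_on F D \<longleftrightarrow>
     holomorphic_map_on F D \<and>
     (\<forall>z\<in>D. inj (frechet_derivative F (at z))) \<and>
     (\<exists>G. homeomorphism D (F ` D) F G)"

(* s_D(z;F); z enters only through the requirement F z = 0 below. *)
definition squeezing_via :: "(complex^'n) set \<Rightarrow> (complex^'n \<Rightarrow> complex^'n) \<Rightarrow> real" where
  "squeezing_via D F = Sup {r. r > 0 \<and> ball 0 r \<subseteq> F ` D}"

(* Both real suprema are suprema of non-empty sets bounded by 1 when D is a bounded domain and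
   z \<in> D: F ` D is an open neighbourhood of 0 inside the unit ball, and a suitable affine map
   is an admissible F. *)
definition squeezing :: "(complex^'n) set \<Rightarrow> complex^'n \<Rightarrow> real" where
  "squeezing D z =
     Sup {squeezing_via D F | F :: complex^'n \<Rightarrow> complex^'n.
            holomorphic_embedding_on F D \<and> F ` D \<subseteq> ball 0 1 \<and> F z = 0}"

(* Plurisubharmonicity of a continuous real-valued function: the sub-mean value inequality on
   every closed analytic disc in D lying in a complex line. *)
definition continuous_plurisubharmonic_on ::
    "(complex^'n \<Rightarrow> real) \<Rightarrow> (complex^'n) set \<Rightarrow> bool" where
  "continuous_plurisubharmonic_on u D \<longleftrightarrow>
     continuous_on D u \<and>
     (\<forall>a b. (\<forall>\<zeta>. norm \<zeta> \<le> 1 \<longrightarrow> a + \<zeta> *s b \<in> D) \<longrightarrow>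
        u a \<le> 1 / (2 * pi) * integral {0..2 * pi} (\<lambda>t. u (a + cis t *s b)))"

(* Existence of a continuous plurisubharmonic exhaustion function. *)
definition pseudoconvex :: "(complex^'n) set \<Rightarrow> bool" where
  "pseudoconvex D \<longleftrightarrow>
     open D \<and>
     (\<exists>u. continuous_plurisubharmonic_on u D \<and> (\<forall>c. compact {z\<in>D. u z \<le> c}))"

definition nowhere_dense :: "'a::topological_space set \<Rightarrow> bool" where
  "nowhere_dense A \<longleftrightarrow> interior (closure A) = {}"

definition locally_separating_at :: "(complex^'n) set \<Rightarrow> complex^'n \<Rightarrow> bool" where
  "locally_separating_at A q \<longleftrightarrow>
     nowhere_dense A \<and> q \<in> A \<and>
     (\<exists>r>0. \<exists>C1\<in>components (ball q r - A). \<exists>C2\<in>components (ball q r - A). C1 \<noteq> C2)"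

end

theory Submission
  imports Defs "HOL-Complex_Analysis.Complex_Analysis"
begin

text \<open>
  Let \<open>F\<close> embed a bounded domain \<open>D\<close> into the unit ball with \<open>F x = 0\<close>, and let \<open>F ` D\<close> contain the
  ball of radius \<open>r\<close> about \<open>0\<close>. Suppose that bounded holomorphic functions on \<open>D\<close> extend, with locally
  uniform bounds, along a complex direction beyond the boundary near \<open>p\<close>. For \<open>x\<close> near \<open>p\<close> the
  extension of \<open>F\<close> is then Lipschitz on that line, with a constant independent of \<open>F\<close>, so it maps a
  disc about \<open>x\<close> of radius comparable to \<open>r\<close> into the ball of radius \<open>r\<close>. Composed with the inverse of
  \<open>F\<close> it is a holomorphic map from this disc into \<open>D\<close> which is the identity near \<open>x\<close>, hence everywhere,
  and so the disc lies in \<open>D\<close> (lemma \<open>disc_in_embedded_domain\<close>). As \<open>x\<close> tends to \<open>p\<close>, the complement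
  of \<open>D\<close> comes arbitrarily near to \<open>x\<close> on the line, and \<open>r\<close> is forced to \<open>0\<close>.

  What is needed is therefore a bounded pseudoconvex domain such that bounded holomorphic functions
  extend across a piece of its boundary which has points of the exterior nearby. Sibony found such
  domains: take \<open>\<bar>w\<bar> < exp (- V z)\<close> over the unit disc, where \<open>V \<ge> 0\<close> is a bounded continuous
  subharmonic function, not identically zero, which vanishes on a set \<open>Z\<close> so dense near the unit
  circle that a bounded holomorphic function on the disc is bounded by its supremum over \<open>Z\<close>
  (lemma \<open>dominating_root_circles\<close>). If a holomorphic function on the domain is bounded by \<open>1\<close>, its
  \<open>k\<close>-th Taylor coefficient in \<open>w\<close> is bounded by \<open>exp (k V z)\<close>. It is thus a bounded function of \<open>z\<close>
  which is at most \<open>1\<close> on \<open>Z\<close>, hence at most \<open>1\<close> everywhere, and the Taylor series converges for all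
  \<open>\<bar>w\<bar> < 1\<close> (lemma \<open>slice_extension\<close>). The further coordinates only range over discs.

  Here \<open>exp V\<close> is the maximum of \<open>1\<close> and 32 times the product of \<open>\<bar>q\<^sub>j\<bar>\<close> to the power \<open>1 / 2 ^ j\<close>,
  where the zeros of \<open>q\<^sub>j\<close> are \<open>j\<^sup>2\<close> equally spaced points on the circle of radius \<open>2 powr (- 1 / j)\<close>.
  Infinite products and fractional powers are avoided by working with the polynomials
  \<open>H\<^sub>m = (32 w) ^ (2 ^ m)\<close> times the product of \<open>q\<^sub>j ^ (2 ^ (m - j))\<close> over \<open>1 \<le> j \<le> m\<close>. They satisfy
  \<open>H\<^sub>m\<^sub>+\<^sub>1 = H\<^sub>m\<^sup>2 q\<^sub>m\<^sub>+\<^sub>1\<close>, and the domain consists of the points where \<open>\<bar>H\<^sub>m\<bar> < 1\<close> for some \<open>m\<close>, as in a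
  basin of attraction: once this happens the sequence tends to \<open>0\<close> faster than geometrically, so the
  sum of all \<open>\<bar>H\<^sub>m\<bar>\<close> is a plurisubharmonic function that blows up at the boundary points inside the
  polydisc, while a large value of \<open>\<bar>H\<^sub>m\<bar>\<close> for a late \<open>m\<close> keeps a whole neighbourhood out of the domain.
\<close>

unbundle no fps_syntax

section \<open>Bounded holomorphic functions of one variable\<close>

lemma norm_le_circle_mean:
  assumes "f holomorphic_on UNIV"
  shows "norm (f 0) \<le> 1 / (2 * pi) * integral {0..2 * pi} (\<lambda>t. norm (f (cis t)))"
proof -
  have cont: "continuous_on A (\<lambda>t. f (cis t))" for A
    by (rule continuous_on_compose2[of UNIV f])
      (use assms in \<open>auto intro!: continuous_intros holomorphic_on_imp_continuous_on\<close>)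
  have "((\<lambda>u. f u / (u - 0)) has_contour_integral (2 * of_real pi * \<i> * f 0)) (circlepath 0 1)"
    by (rule Cauchy_integral_circlepath_simple)
      (use assms holomorphic_on_subset in auto)
  then have "((\<lambda>t. f (cis t) / cis t * \<i> * cis t) has_integral (2 * of_real pi * \<i> * f 0)) {0..2*pi}"
    unfolding circlepath_def by (subst (asm) has_contour_integral_part_circlepath_iff) auto
  then have "((\<lambda>t. \<i> * f (cis t)) has_integral (2 * of_real pi * \<i> * f 0)) {0..2*pi}"
    by (simp add: mult.commute)
  then have "2 * of_real pi * \<i> * f 0 = integral {0..2*pi} (\<lambda>t. \<i> * f (cis t))"
    by (simp only: integral_unique)
  also have "norm \<dots> \<le> integral {0..2*pi} (\<lambda>t. norm (\<i> * f (cis t)))"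
    by (rule integral_norm_bound_integral)
      (auto intro!: integrable_continuous_interval continuous_intros cont)
  finally have "norm (2 * of_real pi * \<i> * f 0) \<le> integral {0..2*pi} (\<lambda>t. norm (\<i> * f (cis t)))" .
  then show ?thesis by (simp add: norm_mult field_simps)
qed

text \<open>
  Cauchy's inequality for a bound on the open disc only: it holds on the circles of radius \<open>s < r\<close>, and
  \<open>s\<close> tends to \<open>r\<close>.
\<close>
lemma deriv_at_centre_bound:
  assumes f: "f holomorphic_on ball c r" and "0 < r"
    and B: "\<And>w. w \<in> ball c r \<Longrightarrow> norm (f w) \<le> B"
  shows "norm ((deriv ^^ k) f c) \<le> fact k * B / r ^ k"
proof -
  have "((\<lambda>s. fact k * B / s ^ k) \<longlongrightarrow> fact k * B / r ^ k) (at_left r)"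
    using \<open>0 < r\<close> by (intro tendsto_intros) auto
  moreover have "\<forall>\<^sub>F s in at_left r. norm ((deriv ^^ k) f c) \<le> fact k * B / s ^ k"
    using eventually_at_left_real[OF \<open>0 < r\<close>]
  proof eventually_elim
    case (elim s)
    then have "cball c s \<subseteq> ball c r" by (auto simp: dist_norm)
    then show ?case
      using elim by (intro Cauchy_inequality holomorphic_on_imp_continuous_on
          holomorphic_on_subset[OF f] B) (auto simp: dist_norm)
  qed
  ultimately show ?thesis
    by (intro tendsto_lowerbound[where F = "at_left r"]) (auto simp: trivial_limit_at_left_real)
qed

lemma lipschitz_inside_ball:
  assumes f: "f holomorphic_on ball c r" and d: "0 < d" and s: "s + d \<le> r"
    and B: "\<And>w. w \<in> ball c (s + d) \<Longrightarrow> norm (f w) \<le> B"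
    and x: "x \<in> ball c s" "y \<in> ball c s"
  shows "norm (f x - f y) \<le> B / d * norm (x - y)"
proof (rule field_differentiable_bound[OF convex_ball _ _ x])
  fix z assume z: "z \<in> ball c s"
  have sub: "ball z d \<subseteq> ball c (s + d)"
    using z d by (intro subsetI) (simp, metis add_strict_mono dist_triangle_lt dist_commute add.commute)
  have "z \<in> ball c r" using z d s by auto
  then show "(f has_field_derivative deriv f z) (at z within ball c s)"
    using f holomorphic_derivI[OF f open_ball] has_field_derivative_at_within by blast
  have "norm ((deriv ^^ 1) f z) \<le> fact 1 * B / d ^ 1"
    by (rule deriv_at_centre_bound) (use sub d s B in \<open>auto intro!: holomorphic_on_subset[OF f]\<close>)
  then show "norm (deriv f z) \<le> B / d" by simp
qed

lemma close_root_on_circle: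
  assumes "0 < r" "0 < n" "norm z = r"
  obtains a :: complex where "a ^ n = of_real (r ^ n)" "norm (z - a) \<le> 2 * pi * r / real n" "norm a = r"
proof -
  define t where "t = Arg2pi z"
  have z: "z = of_real r * cis t"
    using Arg2pi[of z] assms by (simp add: t_def cis_conv_exp is_Arg_def)
  define j where "j = \<lfloor>t * n / (2*pi)\<rfloor>"
  define s where "s = 2 * pi * j / n"
  define a where "a = of_real r * cis s"
  have j: "j \<le> t * n / (2*pi)" "t * n / (2*pi) < j + 1" by (auto simp: j_def)
  have "\<bar>t - s\<bar> \<le> 2 * pi / n"
  proof -
    have "2 * pi * j / n \<le> t" "t < 2 * pi * (j + 1) / n"
      using j assms by (simp_all add: field_simps)
    moreover have "2 * pi * (j + 1) / n = s + 2 * pi / n" by (simp add: s_def algebra_simps add_divide_distrib)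
    ultimately show ?thesis by (simp add: s_def abs_le_iff)
  qed
  moreover have "norm (cis t - cis s) \<le> \<bar>t - s\<bar>"
  proof -
    have "cis t - cis s = cis s * (cis (t - s) - 1)"
      by (simp add: algebra_simps cis_mult)
    then have "norm (cis t - cis s) = norm (exp (\<i> * of_real (t - s)) - 1)"
      by (metis norm_mult norm_cis cis_conv_exp mult_1_left)
    then show ?thesis
      using abs_sin_x_le_abs_x[of "(t - s) / 2"] by (simp add: dist_exp_i_1 del: of_real_diff)
  qed
  ultimately have "norm (cis t - cis s) \<le> 2 * pi / n" by linarith
  moreover have "z - a = of_real r * (cis t - cis s)" by (simp add: z a_def algebra_simps)
  ultimately have "norm (z - a) \<le> r * (2 * pi / n)"
    using \<open>0 < r\<close> by (simp only: norm_mult norm_of_real abs_of_pos mult_left_mono less_imp_le)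
  moreover have "cis s ^ n = 1"
  proof -
    have "real n * s = 2 * pi * of_int j" using assms by (simp add: s_def)
    then show ?thesis using cis_multiple_2pi[of "of_int j"] by (simp add: Complex.DeMoivre)
  qed
  then have "a ^ n = of_real (r ^ n)" by (simp add: a_def power_mult_distrib)
  ultimately show ?thesis using that[of a] assms by (simp add: a_def norm_mult mult.commute)
qed

text \<open>
  By Bernoulli's inequality the \<open>m\<close>-th power of the right-hand side is at least \<open>1/2\<close>.
\<close>
lemma radius_bound:
  assumes "0 < m"
  shows "2 powr (- 1 / real m) \<le> 1 - 1 / (2 * real m)"
proof -
  have "1 + real m * (- 1 / (2 * real m)) \<le> (1 + (- 1 / (2 * real m))) ^ m"
    by (rule Bernoulli_inequality) (use assms in \<open>simp add: field_simps\<close>)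
  then have h: "1/2 \<le> (1 - 1 / (2 * real m)) ^ m" using assms by simp
  have "(2 powr (- 1 / real m)) ^ m = 1/2"
    using assms by (simp add: powr_realpow[symmetric] powr_powr)
  then have "(2 powr (- 1 / real m)) ^ m \<le> (1 - 1 / (2 * real m)) ^ m" using h by linarith
  moreover have "0 \<le> 1 - 1 / (2 * real m)" using assms by simp
  ultimately show ?thesis using assms by (simp only: power_mono_iff powr_ge_zero)
qed

text \<open>
  On the circle of radius \<open>2 powr (- 1 / m)\<close> the given points have spacing of order \<open>1 / m\<^sup>2\<close>, whereas
  the distance to the unit circle is of order \<open>1 / m\<close>, so that \<open>\<bar>g'\<bar>\<close> is at most of order \<open>B m\<close> there.
  Hence \<open>\<bar>g\<bar> \<le> 1 + O (B / m)\<close> on that circle, by the maximum principle inside it, and \<open>m\<close> is arbitrary.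
\<close>
lemma dominating_root_circles:
  assumes g: "g holomorphic_on ball 0 1"
    and bdd: "\<And>z. z \<in> ball 0 1 \<Longrightarrow> norm (g z) \<le> B"
    and roots: "\<And>z m. \<lbrakk>0 < m; z \<in> ball 0 1; z ^ (m\<^sup>2) = of_real ((1/2) ^ m)\<rbrakk> \<Longrightarrow> norm (g z) \<le> 1"
    and z: "z \<in> ball 0 1"
  shows "norm (g z) \<le> 1"
proof -
  have "B \<ge> 0" using bdd[OF z] norm_ge_zero[of "g z"] by linarith
  have *: "norm (g z) \<le> 1 + 8 * pi * B / real m" if m: "0 < m" and zm: "norm z \<le> 2 powr (- 1 / real m)" for m
  proof -
    define r where "r = 2 powr (- 1 / real m)"
    have r: "0 < r" "r \<le> 1 - 1 / (2 * real m)" using radius_bound[OF m] by (auto simp: r_def)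
    have rm: "r ^ (m\<^sup>2) = (1/2) ^ m"
    proof -
      have "r ^ m = 1/2"
        using m by (simp add: r_def powr_realpow[symmetric] powr_powr)
      then show ?thesis by (simp only: power2_eq_square power_mult)
    qed
    have r1: "r < 1" 
    proof -
      have "0 < 1 / (2 * real m)" using m by simp
      then show ?thesis using r(2) by linarith
    qed
    have circ: "norm (g x) \<le> 1 + 8 * pi * B / real m" if x: "norm x = r" for x
    proof -
      obtain a where a: "a ^ (m\<^sup>2) = of_real (r ^ (m\<^sup>2))" "norm (x - a) \<le> 2 * pi * r / real (m\<^sup>2)" "norm a = r"
        using close_root_on_circle[OF r(1), of "m\<^sup>2" x] x m by auto
      have ga: "norm (g a) \<le> 1" using roots[OF m, of a] a rm r1 by simp
      have "norm (g x - g a) \<le> B / (1 / (4 * real m)) * norm (x - a)"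
        by (rule lipschitz_inside_ball[OF g, of _ "1 - 1 / (4 * real m)"])
          (use bdd x a r m in \<open>auto simp: field_simps\<close>)
      also have "\<dots> \<le> B / (1 / (4 * real m)) * (2 * pi * r / real (m\<^sup>2))"
        using a \<open>B \<ge> 0\<close> by (intro mult_left_mono) auto
      also have "\<dots> = 8 * pi * B / real m * r" using m by (simp add: field_simps power2_eq_square)
      also have "\<dots> \<le> 8 * pi * B / real m" using r1 \<open>B \<ge> 0\<close> by (intro mult_left_le) auto
      finally show ?thesis using ga norm_triangle_ineq2[of "g x" "g a"] by linarith
    qed
    show ?thesis
      by (rule maximum_modulus_frontier[of g "cball 0 r"])
        (use r1 circ zm in \<open>auto simp: r_def intro!: holomorphic_on_subset[OF g] holomorphic_on_imp_continuous_on\<close>)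
  qed
  have "(\<lambda>m. 2 powr (- 1 / real m)) \<longlonglongrightarrow> 1" by real_asymp
  then have "\<forall>\<^sub>F m in sequentially. norm z < 2 powr (- 1 / real m)"
    using z by (intro order_tendstoD) auto
  then have "\<forall>\<^sub>F m in sequentially. norm (g z) \<le> 1 + 8 * pi * B / real m"
    using eventually_gt_at_top[of 0] by eventually_elim (auto intro: *)
  moreover have "(\<lambda>m. 1 + 8 * pi * B / real m) \<longlonglongrightarrow> 1" by real_asymp
  ultimately show ?thesis by (intro tendsto_lowerbound) auto
qed

text \<open>
  The coefficient is a Cauchy integral over a circle in the second variable. Its integrals over
  triangles in the first variable vanish after exchanging the order of integration, so Morera's
  theorem applies.
\<close>
lemma holomorphic_taylor_coefficient:
  fixes \<Phi> :: "complex \<Rightarrow> complex \<Rightarrow> complex"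
  assumes S: "open S" and R: "0 < R"
    and cont: "continuous_on (S \<times> ball 0 R) (\<lambda>(z, w). \<Phi> z w)"
    and hz: "\<And>w. w \<in> ball 0 R \<Longrightarrow> (\<lambda>z. \<Phi> z w) holomorphic_on S"
    and hw: "\<And>z. z \<in> S \<Longrightarrow> \<Phi> z holomorphic_on ball 0 R"
  shows "(\<lambda>z. (deriv ^^ k) (\<Phi> z) 0) holomorphic_on S"
proof -
  define r where "r = R / 2"
  have r: "0 < r" "r < R" using R by (auto simp: r_def)
  define \<Psi> where "\<Psi> z w = \<Phi> z w / w ^ Suc k" for z w
  have sub: "cball 0 r \<subseteq> ball 0 R" using r by auto
  have path: "path_image (circlepath 0 r) \<subseteq> ball 0 R - {0}" using r by (auto simp: path_image_circlepath)
  have contC: "continuous_on (S \<times> path_image (circlepath 0 r)) (\<lambda>(z, w). \<Psi> z w)"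
    unfolding \<Psi>_def case_prod_unfold
    by (rule continuous_on_divide[OF continuous_on_subset[OF cont[unfolded case_prod_unfold]]])
      (use path in \<open>auto intro!: continuous_intros\<close>)
  have cont1: "continuous_on S (\<lambda>z. contour_integral (circlepath 0 r) (\<Psi> z))"
  proof -
    have "continuous_on S (\<lambda>z. integral (cbox 0 1) (\<lambda>t. \<Psi> z (circlepath 0 r t) * vector_derivative (circlepath 0 r) (at t)))"
    proof (rule integral_continuous_on_param)
      have "continuous_on (S \<times> cbox 0 1) (\<lambda>p. (\<lambda>(z, w). \<Psi> z w) (fst p, circlepath 0 r (snd p)))"
        by (rule continuous_on_compose2[OF contC])
          (auto intro!: continuous_intros simp: path_image_def circlepath split: prod.splits)
      then show "continuous_on (S \<times> cbox 0 1) (\<lambda>(z, t). \<Psi> z (circlepath 0 r t) * vector_derivative (circlepath 0 r) (at t))"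
        by (auto intro!: continuous_intros simp: case_prod_unfold vector_derivative_circlepath)
    qed
    then show ?thesis by (simp add: contour_integral_integral)
  qed
  have "(\<lambda>z. contour_integral (circlepath 0 r) (\<Psi> z)) analytic_on S"
  proof (rule Morera_triangle[OF cont1 S], rule impI)
    fix a b c assume abc: "convex hull {a, b, c} \<subseteq> S"
    have seg: "closed_segment a b \<subseteq> S" "closed_segment b c \<subseteq> S" "closed_segment c a \<subseteq> S"
      using abc hull_mono[of "{a,b}" "{a,b,c}" convex] hull_mono[of "{b,c}" "{a,b,c}" convex]
        hull_mono[of "{c,a}" "{a,b,c}" convex]
      by (auto simp: segment_convex_hull)
    define I where "I u v w = contour_integral (linepath u v) (\<lambda>z. \<Psi> z w)" for u v w
    have swap: "contour_integral (linepath u v) (\<lambda>z. contour_integral (circlepath 0 r) (\<Psi> z))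
        = contour_integral (circlepath 0 r) (I u v)"
      and int: "(I u v) contour_integrable_on (circlepath 0 r)"
      if uv: "closed_segment u v \<subseteq> S" for u v
    proof -
      have cuv: "continuous_on (closed_segment u v \<times> path_image (circlepath 0 r)) (\<lambda>(z, w). \<Psi> z w)"
        by (rule continuous_on_subset[OF contC]) (use uv in auto)
      show "contour_integral (linepath u v) (\<lambda>z. contour_integral (circlepath 0 r) (\<Psi> z))
        = contour_integral (circlepath 0 r) (I u v)"
        unfolding I_def
        by (rule contour_integral_swap) (use cuv in \<open>auto simp: vector_derivative_circlepath intro!: continuous_intros\<close>)
      have lp: "continuous_on A (\<lambda>p. linepath u v (snd p))" for A :: "(complex \<times> real) set"
        unfolding linepath_def by (intro continuous_intros)
      have "continuous_on (path_image (circlepath 0 r)) (\<lambda>w. integral (cbox 0 1) (\<lambda>t. \<Psi> (linepath u v t) w * (v - u)))"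
      proof (rule integral_continuous_on_param)
        have "continuous_on (path_image (circlepath 0 r) \<times> cbox 0 1) (\<lambda>p. (\<lambda>(z, w). \<Psi> z w) (linepath u v (snd p), fst p))"
          by (rule continuous_on_compose2[OF cuv])
            (auto simp: linepath_in_path intro!: continuous_intros lp simp del: path_image_circlepath)
        then show "continuous_on (path_image (circlepath 0 r) \<times> cbox 0 1) (\<lambda>(w, t). \<Psi> (linepath u v t) w * (v - u))"
          by (auto intro!: continuous_intros simp: case_prod_unfold)
      qed
      then have "continuous_on (path_image (circlepath 0 r)) (I u v)"
        by (simp add: I_def[abs_def] contour_integral_integral)
      then show "(I u v) contour_integrable_on (circlepath 0 r)"
        by (rule contour_integrable_continuous_circlepath)
    qed
    have "I a b w + I b c w + I c a w = 0" if w: "w \<in> path_image (circlepath 0 r)" for w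
    proof -
      have "(\<lambda>z. \<Psi> z w) holomorphic_on S"
        unfolding \<Psi>_def using w path by (intro holomorphic_intros hz) auto
      then have h: "(\<lambda>z. \<Psi> z w) holomorphic_on (convex hull {a, b, c})" using abc holomorphic_on_subset by blast
      have "((\<lambda>z. \<Psi> z w) has_contour_integral 0) (linepath a b +++ linepath b c +++ linepath c a)"
        by (rule Cauchy_theorem_triangle[OF h])
      moreover have "(\<lambda>z. \<Psi> z w) contour_integrable_on (linepath u v)" if "closed_segment u v \<subseteq> S" for u v
        using \<open>(\<lambda>z. \<Psi> z w) holomorphic_on S\<close> that
        by (intro contour_integrable_continuous_linepath holomorphic_on_imp_continuous_on) (auto intro: holomorphic_on_subset)
      ultimately show ?thesis
        using seg unfolding I_def
        by (auto dest!: contour_integral_unique simp: add.assoc)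
    qed
    then have "contour_integral (circlepath 0 r) (\<lambda>w. I a b w + I b c w + I c a w) = contour_integral (circlepath 0 r) (\<lambda>w. 0)"
      by (intro contour_integral_eq) auto
    then show "contour_integral (linepath a b) (\<lambda>z. contour_integral (circlepath 0 r) (\<Psi> z)) +
       contour_integral (linepath b c) (\<lambda>z. contour_integral (circlepath 0 r) (\<Psi> z)) +
       contour_integral (linepath c a) (\<lambda>z. contour_integral (circlepath 0 r) (\<Psi> z)) = 0"
      using seg by (simp add: swap int contour_integral_add contour_integrable_add)
  qed
  then have "(\<lambda>z. fact k / (2 * pi * \<i>) * contour_integral (circlepath 0 r) (\<Psi> z)) holomorphic_on S"
    by (intro holomorphic_intros) (rule analytic_imp_holomorphic)
  moreover have "fact k / (2 * pi * \<i>) * contour_integral (circlepath 0 r) (\<Psi> z) = (deriv ^^ k) (\<Phi> z) 0" if "z \<in> S" for z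
  proof -
    have "((\<lambda>w. \<Phi> z w / (w - 0) ^ Suc k) has_contour_integral (2 * pi * \<i> / fact k * (deriv ^^ k) (\<Phi> z) 0)) (circlepath 0 r)"
      by (rule Cauchy_has_contour_integral_higher_derivative_circlepath)
        (use hw[OF that] sub r in \<open>auto intro: holomorphic_on_subset intro!: holomorphic_on_imp_continuous_on\<close>)
    then have "contour_integral (circlepath 0 r) (\<Psi> z) = 2 * pi * \<i> / fact k * (deriv ^^ k) (\<Phi> z) 0"
      unfolding \<Psi>_def by (simp add: contour_integral_unique)
    then show ?thesis by simp
  qed
  ultimately show ?thesis by (rule holomorphic_transform)
qed

section \<open>The polynomials that define the domain\<close>

text \<open>
  The zeros are \<open>m\<^sup>2\<close> equally spaced points on the circle of radius \<open>2 powr (- 1 / m)\<close>. The denominator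
  normalises the supremum norm on the unit disc to at most \<open>1\<close>.
\<close>
definition circle_factor :: "nat \<Rightarrow> complex \<Rightarrow> complex" where
  "circle_factor m z = (of_real ((1/2) ^ m) - z ^ (m\<^sup>2)) / 2"

text \<open>
  The polynomials \<open>H\<^sub>m\<close> of the introduction. The constant \<open>32\<close> makes the point with \<open>z = 0\<close> and
  \<open>w = 1 / 2\<close> escape from the start: there the initial value is \<open>2 ^ 4\<close>, as \<open>tower_escape\<close> requires.
\<close>
fun tower :: "nat \<Rightarrow> complex \<Rightarrow> complex \<Rightarrow> complex" where
  "tower 0 z w = 32 * w"
| "tower (Suc m) z w = (tower m z w)\<^sup>2 * circle_factor (Suc m) z"

lemma holomorphic_on_tower [holomorphic_intros]:
  assumes "f holomorphic_on A" "g holomorphic_on A"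
  shows "(\<lambda>x. tower m (f x) (g x)) holomorphic_on A"
  by (induction m) (auto intro!: holomorphic_intros assms simp: circle_factor_def)

lemma continuous_on_tower [continuous_intros]:
  fixes f g :: "'a::topological_space \<Rightarrow> complex"
  assumes "continuous_on A f" "continuous_on A g"
  shows "continuous_on A (\<lambda>x. tower m (f x) (g x))"
  by (induction m) (auto intro!: continuous_intros assms simp: circle_factor_def)

lemma norm_circle_factor_le_1:
  assumes "norm z \<le> 1"
  shows "norm (circle_factor m z) \<le> 1"
proof -
  have "norm (of_real ((1/2) ^ m) - z ^ (m\<^sup>2)) \<le> norm (of_real ((1/2) ^ m) :: complex) + norm (z ^ (m\<^sup>2))"
    by (rule norm_triangle_ineq4)
  also have "\<dots> \<le> 1 + 1"
    using assms by (intro add_mono) (auto simp: norm_power power_le_one)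
  finally show ?thesis by (simp add: circle_factor_def norm_divide)
qed

lemma tower_scale: "tower m z (c * w) = c ^ (2 ^ m) * tower m z w"
  by (induction m) (auto simp: power_mult_distrib power_mult[symmetric] mult.commute)

lemma tower_eq_0:
  assumes "0 < m" "z ^ (m\<^sup>2) = of_real ((1/2) ^ m)"
  shows "tower m z w = 0"
  using assms by (cases m) (auto simp: circle_factor_def)

text \<open>
  Squaring doubles the exponent of \<open>\<rho>\<close> at each step; one more factor per step is enough for the
  convergence of the series below.
\<close>
lemma tower_decay:
  assumes "norm z \<le> 1" "norm (tower m z w) \<le> \<rho>" "\<rho> \<le> 1"
  shows "norm (tower (m + j) z w) \<le> \<rho> ^ Suc j"
proof (induction j)
  case 0
  then show ?case using assms by simp
next
  case (Suc j)
  have "0 \<le> \<rho>" using assms(2) norm_ge_zero order_trans by blast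
  have "norm (tower (m + Suc j) z w) = (norm (tower (m + j) z w))\<^sup>2 * norm (circle_factor (Suc (m + j)) z)"
    by (simp add: norm_mult norm_power)
  also have "\<dots> \<le> (\<rho> ^ Suc j)\<^sup>2 * 1"
    using Suc assms \<open>0 \<le> \<rho>\<close> by (intro mult_mono power_mono norm_circle_factor_le_1) auto
  also have "\<dots> = \<rho> ^ (Suc j * 2)" by (simp only: power_mult mult_1_right)
  also have "\<dots> \<le> \<rho> ^ Suc (Suc j)"
    using \<open>0 \<le> \<rho>\<close> assms by (intro power_decreasing) auto
  finally show ?case .
qed

lemma tower_less_1_mono:
  assumes "norm z \<le> 1" "norm (tower m z w) < 1" "m \<le> k"
  shows "norm (tower k z w) < 1"
proof -
  have "norm (tower (m + (k - m)) z w) \<le> norm (tower m z w) ^ Suc (k - m)"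
    by (rule tower_decay) (use assms in auto)
  also have "\<dots> \<le> norm (tower m z w) ^ 1" using assms by (intro power_decreasing) auto
  also have "\<dots> < 1" using assms by simp
  finally show ?thesis using assms by simp
qed

text \<open>
  On a smaller disc \<open>z ^ (m\<^sup>2)\<close> is eventually much smaller than \<open>(1/2) ^ m\<close>, since \<open>m\<^sup>2\<close> outgrows \<open>m\<close>.
\<close>
lemma circle_factor_lower_bound:
  assumes "\<rho> < 1"
  obtains M where "\<And>m z. \<lbrakk>M \<le> m; norm z \<le> \<rho>\<rbrakk> \<Longrightarrow> (1/2) ^ (m + 2) \<le> norm (circle_factor m z)"
proof (cases "0 \<le> \<rho>")
  case True
  have "(\<lambda>m. \<rho> ^ m) \<longlonglongrightarrow> 0" using True assms by (intro LIMSEQ_realpow_zero)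
  then have "\<forall>\<^sub>F m in sequentially. \<rho> ^ m < 1/4" by (rule order_tendstoD) simp
  then obtain M where M: "\<And>m. M \<le> m \<Longrightarrow> \<rho> ^ m < 1/4" by (auto simp: eventually_sequentially)
  show ?thesis
  proof (rule that[of "Suc M"])
    fix m and z :: complex assume m: "Suc M \<le> m" and z: "norm z \<le> \<rho>"
    have "norm (z ^ (m\<^sup>2)) \<le> \<rho> ^ (m\<^sup>2)" using z by (simp add: norm_power power_mono)
    also have "\<dots> = (\<rho> ^ m) ^ m" by (simp only: power2_eq_square power_mult)
    also have "\<dots> \<le> (1/4) ^ m" using M[of m] m True by (intro power_mono) auto
    also have "(1/4 :: real) ^ m = (1/2) ^ (m * 2)" by (simp only: mult.commute[of m] power_mult) (simp add: power2_eq_square)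
    also have "\<dots> \<le> (1/2) ^ (m + 1)" using m by (intro power_decreasing) auto
    finally have "norm (z ^ (m\<^sup>2)) \<le> (1/2) ^ m / 2" by simp
    moreover have "norm (of_real ((1/2) ^ m) :: complex) - norm (z ^ (m\<^sup>2)) \<le> norm (of_real ((1/2) ^ m) - z ^ (m\<^sup>2))"
      by (rule norm_triangle_ineq2)
    moreover have "norm (of_real ((1/2) ^ m) :: complex) = (1/2) ^ m" by (simp only: norm_of_real) simp
    ultimately have "(1/2) ^ m / 2 \<le> norm (of_real ((1/2) ^ m) - z ^ (m\<^sup>2))" by linarith
    then show "(1/2) ^ (m + 2) \<le> norm (circle_factor m z)" by (simp add: circle_factor_def norm_divide)
  qed
next
  case False
  then have "\<not> norm z \<le> \<rho>" for z :: complex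
    using norm_ge_zero[of z] by linarith
  then show ?thesis by (intro that[of 0]) blast
qed

text \<open>
  Squaring the threshold \<open>2 ^ (m + 4)\<close> and losing the factor \<open>2 ^ (m + 3)\<close> leaves \<open>2 ^ (m + 5)\<close>, which
  is the next threshold. The terms before the \<open>m\<close>-th are at least \<open>1\<close> as well, because a term below
  \<open>1\<close> would force all later ones below \<open>1\<close>.
\<close>
lemma tower_escape:
  assumes z: "norm z \<le> 1"
    and q: "\<And>k. m < k \<Longrightarrow> (1/2) ^ (k + 2) \<le> norm (circle_factor k z)"
    and big: "2 ^ (m + 4) \<le> norm (tower m z w)"
  shows "1 \<le> norm (tower k z w)"
proof -
  have up: "2 ^ (m + j + 4) \<le> norm (tower (m + j) z w)" for j
  proof (induction j)
    case 0
    then show ?case using big by simp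
  next
    case (Suc j)
    have "(2::real) ^ (m + Suc j + 4) = (2 ^ (m + j + 4))\<^sup>2 * (1/2) ^ (Suc (m + j) + 2)"
    proof -
      define x :: real where "x = 2 ^ (m + j)"
      have "(2 ^ (m + j + 4) :: real) = 16 * x" "(2 ^ (m + Suc j + 4) :: real) = 32 * x"
        "(1/2 :: real) ^ (Suc (m + j) + 2) = 1 / (8 * x)" "x \<noteq> 0"
        by (auto simp: x_def power_add power_one_over)
      then show ?thesis by (simp only: power2_eq_square) (simp add: field_simps)
    qed
    also have "\<dots> \<le> (norm (tower (m + j) z w))\<^sup>2 * norm (circle_factor (Suc (m + j)) z)"
      using Suc q[of "Suc (m + j)"] by (intro mult_mono power_mono) auto
    finally show ?case by (simp add: norm_mult norm_power)
  qed
  show ?thesis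
  proof (rule ccontr)
    assume "\<not> 1 \<le> norm (tower k z w)"
    then have "norm (tower (m + k) z w) < 1" using tower_less_1_mono[OF z, of k w "m + k"] by simp
    moreover have "(1::real) \<le> 2 ^ (m + k + 4)" by (rule one_le_power) simp
    ultimately show False using up[of k] by linarith
  qed
qed

lemma tower_at_0:
  assumes "1/2 \<le> norm w"
  shows "1 \<le> norm (tower k 0 w)"
proof (rule tower_escape[where m = 0])
  fix k :: nat
  assume "0 < k"
  then have "norm (circle_factor k 0) = norm (of_real ((1/2) ^ k) :: complex) / 2"
    by (simp only: circle_factor_def) (simp add: norm_divide power_0_left)
  then have "norm (circle_factor k 0) = (1/2) ^ k / 2"
    by (simp only: norm_of_real) simp
  then show "(1/2) ^ (k + 2) \<le> norm (circle_factor k 0)"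
    by (simp only: power_add) (simp add: power2_eq_square)
next
  show "2 ^ (0 + 4) \<le> norm (tower 0 0 w)"
    using assms by (simp add: norm_mult)
qed simp

section \<open>The domain\<close>

definition with_coord :: "complex^'n \<Rightarrow> 'n \<Rightarrow> complex \<Rightarrow> complex^'n" where
  "with_coord x a w = (\<chi> i. if i = a then w else x $ i)"

lemma with_coord_nth [simp]: "with_coord x a w $ i = (if i = a then w else x $ i)"
  by (simp add: with_coord_def)

lemma with_coord_same [simp]: "with_coord x a (x $ a) = x"
  by (simp add: vec_eq_iff)

lemma continuous_on_with_coord [continuous_intros]:
  assumes "continuous_on A f" "continuous_on A g"
  shows "continuous_on A (\<lambda>y. with_coord (f y) a (g y))"
  unfolding with_coord_def
proof (rule continuous_on_vec_lambda)
  show "continuous_on A (\<lambda>y. if i = a then g y else f y $ i)" for i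
    using assms by (cases "i = a") (auto intro!: continuous_intros)
qed

definition polydisc :: "(complex^'n) set" where
  "polydisc = {x. \<forall>i. norm (x $ i) < 1}"

definition sibony_domain :: "'n \<Rightarrow> 'n \<Rightarrow> (complex^'n) set" where
  "sibony_domain a b = {x \<in> polydisc. \<exists>m. norm (tower m (x $ b) (x $ a)) < 1}"

lemma open_polydisc: "open polydisc"
  unfolding polydisc_def Collect_all_eq
  by (intro open_INT ballI open_Collect_less continuous_intros) auto

lemma open_sibony_domain:
  fixes a b :: "'n::finite"
  shows "open (sibony_domain a b)"
proof -
  have "sibony_domain a b = polydisc \<inter> (\<Union>m. {x. norm (tower m (x $ b) (x $ a)) < 1})"
    by (auto simp: sibony_domain_def)
  moreover have "open {x :: complex^'n. norm (tower m (x $ b) (x $ a)) < 1}" for m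
    by (intro open_Collect_less continuous_intros)
  ultimately show ?thesis
    by (simp only:) (intro open_Int open_UN ballI open_polydisc)
qed

lemma bounded_polydisc: "bounded (polydisc :: (complex^'n) set)"
proof (rule boundedI)
  fix x :: "complex^'n" assume "x \<in> polydisc"
  then have "(\<Sum>i\<in>UNIV. norm (x $ i)) \<le> (\<Sum>i\<in>(UNIV::'n set). 1)"
    by (intro sum_mono) (auto simp: polydisc_def less_imp_le)
  then show "norm x \<le> real CARD('n)" using norm_le_l1_cart
    unfolding norm_vec_def by (rule_tac order_trans[OF L2_set_le_sum]) auto
qed

lemma convex_polydisc: "convex polydisc"
  unfolding convex_alt
proof (intro ballI allI impI)
  fix x y :: "complex^'n" and u :: real
  assume xy: "x \<in> polydisc" "y \<in> polydisc" and u: "0 \<le> u \<and> u \<le> 1"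
  have "(1 - u) *\<^sub>R (x $ i) + u *\<^sub>R (y $ i) \<in> ball 0 1" for i
    using xy u convex_ball[of "0::complex" 1, unfolded convex_alt] by (auto simp: polydisc_def)
  then show "(1 - u) *\<^sub>R x + u *\<^sub>R y \<in> polydisc" by (simp add: polydisc_def)
qed

lemma scale_in_sibony_domain:
  assumes "a \<noteq> b" "x \<in> sibony_domain a b" "norm c \<le> 1"
  shows "with_coord x a (c * x $ a) \<in> sibony_domain a b"
proof -
  obtain m where m: "norm (tower m (x $ b) (x $ a)) < 1" and x: "x \<in> polydisc"
    using assms(2) by (auto simp: sibony_domain_def)
  have "norm (tower m (x $ b) (c * x $ a)) = norm c ^ (2 ^ m) * norm (tower m (x $ b) (x $ a))"
    by (simp add: tower_scale norm_mult norm_power)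
  also have "\<dots> \<le> 1 * norm (tower m (x $ b) (x $ a))"
    using assms(3) by (intro mult_right_mono power_le_one) auto
  finally have "norm (tower m (x $ b) (c * x $ a)) < 1" using m by simp
  moreover have "norm (c * x $ a) \<le> 1 * norm (x $ a)"
    unfolding norm_mult using assms(3) by (intro mult_right_mono) auto
  then have "norm (c * x $ a) < 1" using x by (simp add: polydisc_def le_less_trans)
  ultimately show ?thesis using x \<open>a \<noteq> b\<close>
    by (auto simp: sibony_domain_def polydisc_def)
qed

lemma small_coord_in_sibony_domain:
  assumes "a \<noteq> b" "x \<in> polydisc" "norm w < 1 / 32"
  shows "with_coord x a w \<in> sibony_domain a b"
proof -
  have "norm (tower 0 (x $ b) w) < 1" using assms by (simp add: norm_mult)
  then show ?thesis using assms
    by (auto simp: sibony_domain_def polydisc_def intro: exI[of _ 0])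
qed

text \<open>
  Shrinking the coordinate \<open>a\<close> to \<open>0\<close> stays in the domain and ends in a convex slice of the polydisc.
\<close>
lemma connected_sibony_domain:
  fixes a b :: "'n::finite"
  assumes "a \<noteq> b"
  shows "connected (sibony_domain a b)"
proof -
  let ?Z = "polydisc \<inter> {x. x $ a = 0}"
  have Z: "?Z \<subseteq> sibony_domain a b"
    using small_coord_in_sibony_domain[OF assms, of _ 0]
    by (auto; metis with_coord_same norm_zero zero_less_divide_1_iff zero_less_numeral)
  have "convex {x :: complex^'n. x $ a = 0}" by (auto simp: convex_alt)
  then have "connected ?Z" by (intro convex_connected convex_Int convex_polydisc)
  have zero: "0 \<in> ?Z" by (simp add: polydisc_def)
  define S where "S x = closed_segment x (with_coord x a 0) \<union> ?Z" for x
  have "connected (S x)" if "x \<in> sibony_domain a b" for x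
  proof -
    have "with_coord x a 0 \<in> ?Z" using that by (auto simp: sibony_domain_def polydisc_def)
    then show ?thesis unfolding S_def
      by (intro connected_Un connected_segment \<open>connected ?Z\<close>) auto
  qed
  moreover have "closed_segment x (with_coord x a 0) \<subseteq> sibony_domain a b" if x: "x \<in> sibony_domain a b" for x
  proof
    fix y assume "y \<in> closed_segment x (with_coord x a 0)"
    then obtain t where t: "0 \<le> t" "t \<le> 1" "y = (1 - t) *\<^sub>R x + t *\<^sub>R with_coord x a 0"
      by (auto simp: in_segment)
    then have "y = with_coord x a (of_real (1 - t) * x $ a)"
      unfolding t(3) vec_eq_iff vector_add_component vector_scaleR_component
      by (auto simp: scaleR_conv_of_real algebra_simps)
    then show "y \<in> sibony_domain a b"
      using scale_in_sibony_domain[OF assms x, of "of_real (1 - t)"] t by (simp del: of_real_diff)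
  qed
  then have "sibony_domain a b = (\<Union>x\<in>sibony_domain a b. S x)" using Z by (auto simp: S_def)
  moreover have "connected (\<Union>x\<in>sibony_domain a b. S x)"
    by (rule connected_Union) (use calculation(1) zero in \<open>auto simp: S_def\<close>)
  ultimately show ?thesis by simp
qed

text \<open>
  At a point of the polydisc outside the domain all \<open>\<bar>H\<^sub>m\<bar>\<close> are at least \<open>1\<close>. Multiplying the coordinate
  \<open>a\<close> by \<open>c > 1\<close> multiplies \<open>H\<^sub>m\<close> by \<open>c ^ (2 ^ m)\<close>, which exceeds the escape threshold for large \<open>m\<close>.
  To be above the threshold for one late \<open>m\<close> is an open condition that excludes the domain.
\<close>
lemma exterior_of_sibony_domain:
  fixes a b :: "'n::finite"
  assumes "a \<noteq> b" and x: "x \<in> polydisc" "x \<notin> sibony_domain a b" and c: "1 < c"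
  obtains U where "open U" "with_coord x a (of_real c * x $ a) \<in> U" "U \<inter> sibony_domain a b = {}"
proof -
  define \<rho> where "\<rho> = (1 + norm (x $ b)) / 2"
  have \<rho>: "norm (x $ b) < \<rho>" "\<rho> < 1" using x by (auto simp: \<rho>_def polydisc_def)
  obtain M where M: "\<And>m z. \<lbrakk>M \<le> m; norm z \<le> \<rho>\<rbrakk> \<Longrightarrow> (1/2) ^ (m + 2) \<le> norm (circle_factor m z)"
    using circle_factor_lower_bound[OF \<rho>(2)] by blast
  have "filterlim (\<lambda>m. c ^ (2 ^ m) / 2 ^ (m + 4)) at_top sequentially"
  proof -
    have "(\<lambda>m. 2 ^ (m + 4) / c ^ (2 ^ m)) \<longlonglongrightarrow> 0" using c by real_asymp
    then have "filterlim (\<lambda>m. inverse (2 ^ (m + 4) / c ^ (2 ^ m))) at_top sequentially"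
      using c by (intro filterlim_inverse_at_top) auto
    then show ?thesis by simp
  qed
  then have "\<forall>\<^sub>F m in sequentially. 1 < c ^ (2 ^ m) / 2 ^ (m + 4)"
    by (rule filterlim_at_top_dense[THEN iffD1, rule_format])
  then have "\<forall>\<^sub>F m in sequentially. M \<le> m \<and> 1 < c ^ (2 ^ m) / 2 ^ (m + 4)"
    by (intro eventually_conj eventually_ge_at_top)
  then obtain m where m: "M \<le> m" "1 < c ^ (2 ^ m) / 2 ^ (m + 4)"
    by (auto simp: eventually_sequentially)
  define U where "U = {y :: complex^'n. norm (y $ b) < \<rho>} \<inter> {y. 2 ^ (m + 4) < norm (tower m (y $ b) (y $ a))}"
  show ?thesis
  proof (rule that[of U])
    show "open U" unfolding U_def by (intro open_Int open_Collect_less continuous_intros)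
    have "1 \<le> norm (tower m (x $ b) (x $ a))" using x by (auto simp: sibony_domain_def not_less)
    then have "c ^ (2 ^ m) * 1 \<le> norm (tower m (x $ b) (of_real c * x $ a))"
      using c by (simp add: tower_scale norm_mult norm_power)
    moreover have "2 ^ (m + 4) < c ^ (2 ^ m)" using m by (simp add: less_divide_eq)
    ultimately show "with_coord x a (of_real c * x $ a) \<in> U"
      using \<rho> \<open>a \<noteq> b\<close> unfolding U_def by (auto intro: less_le_trans)
    have "y \<notin> sibony_domain a b" if "y \<in> U" for y
    proof -
      have "1 \<le> norm (tower k (y $ b) (y $ a))" for k
        by (rule tower_escape[where m = m]) (use that m M \<rho> in \<open>auto simp: U_def\<close>)
      then show ?thesis by (auto simp: sibony_domain_def not_less)
    qed
    then show "U \<inter> sibony_domain a b = {}" by blast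
  qed
qed

section \<open>A plurisubharmonic exhaustion function\<close>

text \<open>
  All terms are absolute values of polynomials. The powers of the coordinates add up to a geometric
  series that blows up at the boundary of the polydisc, the values of \<open>tower\<close> take care of the
  remaining part of the boundary.
\<close>
definition exhaustion_term :: "'n \<Rightarrow> 'n \<Rightarrow> nat \<Rightarrow> complex^'n \<Rightarrow> real" where
  "exhaustion_term a b m x = norm (tower m (x $ b) (x $ a)) + (\<Sum>i\<in>UNIV. norm (x $ i) ^ m)"

lemma exhaustion_term_nonneg: "0 \<le> exhaustion_term a b m x"
  by (auto simp: exhaustion_term_def intro!: add_nonneg_nonneg sum_nonneg)

lemma continuous_on_exhaustion_term: "continuous_on A (exhaustion_term a b m)"
  unfolding exhaustion_term_def by (intro continuous_intros)

lemma exhaustion_term_submean: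
  "exhaustion_term a b m x
     \<le> 1 / (2 * pi) * integral {0..2 * pi} (\<lambda>t. exhaustion_term a b m (x + cis t *s y))"
proof -
  let ?J = "\<lambda>f. integral {0..2 * pi} (\<lambda>t. norm (f (cis t) :: complex))"
  have entire: "(\<lambda>\<zeta>. (x + \<zeta> *s y) $ i) holomorphic_on UNIV" for i
    by (auto intro!: holomorphic_intros)
  have T: "norm (tower m (x $ b) (x $ a)) \<le> 1 / (2 * pi) * ?J (\<lambda>\<zeta>. tower m ((x + \<zeta> *s y) $ b) ((x + \<zeta> *s y) $ a))"
    using norm_le_circle_mean[OF holomorphic_on_tower[OF entire entire]] by simp
  have P: "norm (x $ i) ^ m \<le> 1 / (2 * pi) * ?J (\<lambda>\<zeta>. (x + \<zeta> *s y) $ i ^ m)" for i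
    using norm_le_circle_mean[OF holomorphic_on_power[OF entire]] by (simp add: norm_power)
  have "continuous_on A (\<lambda>t. (x + cis t *s y) $ i)" for A i
    by (auto intro!: continuous_intros)
  note cont = this[THEN continuous_on_tower[OF _ this], THEN continuous_on_norm]
    continuous_on_norm[OF continuous_on_power[OF this]]
  have "integral {0..2 * pi} (\<lambda>t. exhaustion_term a b m (x + cis t *s y))
      = ?J (\<lambda>\<zeta>. tower m ((x + \<zeta> *s y) $ b) ((x + \<zeta> *s y) $ a)) + (\<Sum>i\<in>UNIV. ?J (\<lambda>\<zeta>. (x + \<zeta> *s y) $ i ^ m))"
  proof -
    have "integral {0..2 * pi} (\<lambda>t. \<Sum>i\<in>UNIV. norm ((x + cis t *s y) $ i ^ m))
        = (\<Sum>i\<in>UNIV. ?J (\<lambda>\<zeta>. (x + \<zeta> *s y) $ i ^ m))"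
      by (rule integral_sum) (intro integrable_continuous_interval cont finite)+
    then show ?thesis
      unfolding exhaustion_term_def norm_power[symmetric]
      by (subst integral_add) (auto intro!: integrable_continuous_interval cont continuous_on_sum
          simp del: vector_add_component vector_smult_component)
  qed
  moreover have "exhaustion_term a b m x \<le> 1 / (2 * pi) * ?J (\<lambda>\<zeta>. tower m ((x + \<zeta> *s y) $ b) ((x + \<zeta> *s y) $ a))
      + (\<Sum>i\<in>UNIV. 1 / (2 * pi) * ?J (\<lambda>\<zeta>. (x + \<zeta> *s y) $ i ^ m))"
    unfolding exhaustion_term_def by (intro add_mono sum_mono T P)
  ultimately show ?thesis
    by (simp only: sum_distrib_left[symmetric] distrib_left[symmetric])
qed

lemma exhaustion_series:
  fixes a b :: "'n::finite"
  assumes x: "x \<in> sibony_domain a b"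
  obtains U where "open U" "x \<in> U"
    "\<And>y. y \<in> U \<Longrightarrow> summable (\<lambda>m. exhaustion_term a b m y)"
    "continuous_on U (\<lambda>y. \<Sum>m. exhaustion_term a b m y)"
proof -
  obtain M where M: "norm (tower M (x $ b) (x $ a)) < 1" "\<And>i. norm (x $ i) < 1"
    using x by (auto simp: sibony_domain_def polydisc_def)
  define t where "t = Max (insert (norm (tower M (x $ b) (x $ a))) (range (\<lambda>i. norm (x $ i))))"
  have "t < 1" unfolding t_def using M by (subst Max_less_iff) auto
  then obtain \<rho> where \<rho>: "t < \<rho>" "\<rho> < 1" using dense by blast
  have t: "norm (tower M (x $ b) (x $ a)) \<le> t" "norm (x $ i) \<le> t" for i
    unfolding t_def by (intro Max_ge; simp)+
  have "0 < \<rho>" using t(1) \<rho>(1) norm_ge_zero by (meson le_less_trans)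
  define U where "U = {y :: complex^'n. norm (tower M (y $ b) (y $ a)) < \<rho>} \<inter> (\<Inter>i. {y. norm (y $ i) < \<rho>})"
  have "open U" unfolding U_def
    by (intro open_Int open_INT ballI open_Collect_less continuous_intros) auto
  moreover have "x \<in> U" using t \<rho> by (auto simp: U_def intro: le_less_trans)
  moreover
  define N where "N m = \<rho> ^ Suc (m - M) + real CARD('n) * \<rho> ^ m" for m
  have bound: "norm (exhaustion_term a b m y) \<le> N m" if "M \<le> m" "y \<in> U" for m y
  proof -
    have "norm (tower (M + (m - M)) (y $ b) (y $ a)) \<le> \<rho> ^ Suc (m - M)"
      by (rule tower_decay) (use that \<rho> in \<open>auto simp: U_def intro: less_imp_le less_trans\<close>)
    moreover have "(\<Sum>i\<in>UNIV. norm (y $ i) ^ m) \<le> (\<Sum>i\<in>(UNIV::'n set). \<rho> ^ m)"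
      using that by (intro sum_mono power_mono) (auto simp: U_def intro: less_imp_le)
    ultimately show ?thesis
      using that exhaustion_term_nonneg[of a b m y] by (simp add: exhaustion_term_def N_def)
  qed
  have "summable (\<lambda>m. \<rho> ^ Suc (m - M))"
    using \<rho> \<open>0 < \<rho>\<close> by (subst summable_iff_shift[of _ M, symmetric]) (simp add: summable_mult)
  then have "summable N" unfolding N_def using \<rho> \<open>0 < \<rho>\<close> by (intro summable_add summable_mult) auto
  have "summable (\<lambda>m. exhaustion_term a b m y)" if "y \<in> U" for y
    by (rule summable_comparison_test[OF _ \<open>summable N\<close>]) (use bound that in blast)
  moreover have "continuous_on U (\<lambda>y. \<Sum>m. exhaustion_term a b m y)"
  proof (rule uniform_limit_theorem[OF _ Weierstrass_m_test_ev[OF _ \<open>summable N\<close>]])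
    show "\<forall>\<^sub>F n in sequentially. \<forall>y\<in>U. norm (exhaustion_term a b n y) \<le> N n"
      using eventually_ge_at_top[of M] by eventually_elim (use bound in blast)
  qed (auto intro!: always_eventually continuous_intros continuous_on_exhaustion_term)
  ultimately show ?thesis by (rule that)
qed

text \<open>
  Off the domain every single term is at least \<open>1\<close>, be it a power of a coordinate or a value of
  \<open>tower\<close>.
\<close>
lemma exhaustion_partial_sums_unbounded:
  assumes x: "x \<notin> sibony_domain a b"
  shows "\<exists>n. c < (\<Sum>m<n. exhaustion_term a b m x)"
proof -
  have "1 \<le> exhaustion_term a b m x" for m
  proof (cases "x \<in> polydisc")
    case True
    then have "1 \<le> norm (tower m (x $ b) (x $ a))" using x by (auto simp: sibony_domain_def not_less)
    moreover have "0 \<le> (\<Sum>i\<in>UNIV. norm (x $ i) ^ m)" by (intro sum_nonneg) auto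
    ultimately show ?thesis by (simp add: exhaustion_term_def)
  next
    case False
    then obtain i where "1 \<le> norm (x $ i)" by (auto simp: polydisc_def not_less)
    then have "1 \<le> norm (x $ i) ^ m" by (rule one_le_power)
    also have "\<dots> \<le> (\<Sum>i\<in>UNIV. norm (x $ i) ^ m)" by (rule member_le_sum) auto
    finally show ?thesis by (simp add: exhaustion_term_def add_increasing)
  qed
  then have "(\<Sum>m<n. 1) \<le> (\<Sum>m<n. exhaustion_term a b m x)" for n by (intro sum_mono)
  moreover obtain n where "c < real n" using reals_Archimedean2 by blast
  ultimately show ?thesis by (auto intro!: exI[of _ n] intro: less_le_trans)
qed

text \<open>
  The sublevel sets of the sum are cut out by its partial sums, which are continuous on the whole space
  and unbounded at each point off the domain; so the sublevel sets are closed in the whole space. The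
  submean inequality passes from the partial sums to their supremum.
\<close>
lemma pseudoconvex_sibony_domain:
  fixes a b :: "'n::finite"
  shows "pseudoconvex (sibony_domain a b)"
proof -
  define u where "u x = (\<Sum>m. exhaustion_term a b m x)" for x
  let ?D = "sibony_domain a b"
  have sm: "summable (\<lambda>m. exhaustion_term a b m x)" if "x \<in> ?D" for x
    using exhaustion_series[OF that] by blast
  have partial: "(\<Sum>m<n. exhaustion_term a b m x) \<le> u x" if "x \<in> ?D" for x n
    unfolding u_def by (intro sum_le_suminf sm that) (auto intro: exhaustion_term_nonneg)
  have cont: "continuous_on ?D u"
    unfolding continuous_on_eq_continuous_at[OF open_sibony_domain]
  proof
    fix x assume "x \<in> ?D"
    then obtain U where U: "open U" "x \<in> U" "continuous_on U u"
      by (rule exhaustion_series) (auto simp: u_def[abs_def])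
    then show "isCont u x" by (simp add: continuous_on_eq_continuous_at)
  qed
  have "continuous_plurisubharmonic_on u ?D"
    unfolding continuous_plurisubharmonic_on_def
  proof (intro conjI cont allI impI)
    fix x y assume disc: "\<forall>\<zeta>. norm \<zeta> \<le> 1 \<longrightarrow> x + \<zeta> *s y \<in> ?D"
    have circ: "x + cis t *s y \<in> ?D" for t using disc by simp
    have x: "x \<in> ?D" using disc[rule_format, of 0] by simp
    have cline: "continuous_on A (\<lambda>t. x + cis t *s y)" for A
      unfolding vector_scalar_mult_def
      by (intro continuous_intros continuous_on_vec_lambda)
    have cu: "continuous_on {0..2*pi} (\<lambda>t. u (x + cis t *s y))"
      by (rule continuous_on_compose2[OF cont]) (use circ cline in auto)
    have "(\<Sum>m<n. exhaustion_term a b m x) \<le> 1 / (2 * pi) * integral {0..2 * pi} (\<lambda>t. u (x + cis t *s y))" for n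
    proof -
      have ce: "continuous_on A (\<lambda>t. exhaustion_term a b m (x + cis t *s y))" for A m
        by (rule continuous_on_compose2[OF continuous_on_exhaustion_term[of UNIV]]) (use cline in auto)
      have "(\<Sum>m<n. exhaustion_term a b m x)
          \<le> (\<Sum>m<n. 1 / (2 * pi) * integral {0..2 * pi} (\<lambda>t. exhaustion_term a b m (x + cis t *s y)))"
        by (intro sum_mono exhaustion_term_submean)
      also have "\<dots> = 1 / (2 * pi) * integral {0..2 * pi} (\<lambda>t. \<Sum>m<n. exhaustion_term a b m (x + cis t *s y))"
        by (subst integral_sum) (auto simp: sum_distrib_left intro!: integrable_continuous_interval ce)
      also have "\<dots> \<le> 1 / (2 * pi) * integral {0..2 * pi} (\<lambda>t. u (x + cis t *s y))"
        by (intro mult_left_mono integral_le integrable_continuous_interval continuous_on_sum ce cu partial circ) auto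
      finally show ?thesis .
    qed
    then show "u x \<le> 1 / (2 * pi) * integral {0..2 * pi} (\<lambda>t. u (x + cis t *s y))"
      unfolding u_def[of x] by (rule suminf_le_const[OF sm[OF x]])
  qed
  moreover have "compact {x \<in> ?D. u x \<le> c}" for c
  proof -
    have "{x \<in> ?D. u x \<le> c} = (\<Inter>n. {x. (\<Sum>m<n. exhaustion_term a b m x) \<le> c})"
    proof (intro equalityI subsetI)
      fix x assume "x \<in> {x \<in> ?D. u x \<le> c}"
      then show "x \<in> (\<Inter>n. {x. (\<Sum>m<n. exhaustion_term a b m x) \<le> c})"
        using partial order_trans by blast
    next
      fix x assume x: "x \<in> (\<Inter>n. {x. (\<Sum>m<n. exhaustion_term a b m x) \<le> c})"
      then have "x \<in> ?D" using exhaustion_partial_sums_unbounded[of x a b c] by (auto simp: not_le[symmetric])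
      moreover have "u x \<le> c" unfolding u_def
        using x by (intro suminf_le_const sm \<open>x \<in> ?D\<close>) auto
      ultimately show "x \<in> {x \<in> ?D. u x \<le> c}" by simp
    qed
    moreover have "closed (\<Inter>n. {x. (\<Sum>m<n. exhaustion_term a b m x) \<le> c})"
      by (intro closed_INT ballI closed_Collect_le continuous_intros continuous_on_exhaustion_term)
    moreover have "bounded {x \<in> ?D. u x \<le> c}"
      by (rule bounded_subset[OF bounded_polydisc]) (auto simp: sibony_domain_def)
    ultimately show ?thesis by (simp add: compact_eq_bounded_closed)
  qed
  ultimately show ?thesis using open_sibony_domain by (auto simp: pseudoconvex_def)
qed

section \<open>Extension of bounded holomorphic functions along slices\<close>

lemma fibre_contains_disc:
  fixes x :: "complex^'n"
  assumes ab: "a \<noteq> b" and x: "x \<in> polydisc" and w: "with_coord x a w \<in> sibony_domain a b"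
  obtains R where "w \<in> ball (0::complex) R" "ball (0::complex) R \<subseteq> {\<zeta>. with_coord x a \<zeta> \<in> sibony_domain a b}"
proof (cases "w = 0")
  case True
  then show ?thesis
    using small_coord_in_sibony_domain[OF ab x] by (intro that[of "1/32"]) auto
next
  case False
  have "continuous_on UNIV (\<lambda>t::real. with_coord x a (of_real t * w))"
    by (intro continuous_intros)
  then have "open ((\<lambda>t::real. with_coord x a (of_real t * w)) -` sibony_domain a b)"
    by (rule open_vimage[OF open_sibony_domain])
  moreover have "1 \<in> (\<lambda>t::real. with_coord x a (of_real t * w)) -` sibony_domain a b" using w by simp
  ultimately obtain e where e: "0 < e" "ball 1 e \<subseteq> (\<lambda>t::real. with_coord x a (of_real t * w)) -` sibony_domain a b"
    unfolding open_contains_ball by blast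
  define t where "t = 1 + e / 2"
  have "t \<in> ball 1 e" using e by (simp add: t_def dist_norm)
  then have tw: "with_coord x a (of_real t * w) \<in> sibony_domain a b" using e by auto
  have t: "1 < t" using e by (simp add: t_def)
  show ?thesis
  proof (rule that[of "t * norm w"])
    show "w \<in> ball 0 (t * norm w)" using False t by simp
    show "ball 0 (t * norm w) \<subseteq> {\<zeta>. with_coord x a \<zeta> \<in> sibony_domain a b}"
    proof
      fix \<zeta> :: complex assume \<zeta>: "\<zeta> \<in> ball 0 (t * norm w)"
      have "with_coord (with_coord x a (of_real t * w)) a
          ((\<zeta> / (of_real t * w)) * (with_coord x a (of_real t * w)) $ a) \<in> sibony_domain a b"
        by (rule scale_in_sibony_domain[OF ab tw])
          (use \<zeta> t False in \<open>auto simp: norm_divide norm_mult divide_le_eq_1\<close>)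
      moreover have "with_coord (with_coord x a (of_real t * w)) a
          ((\<zeta> / (of_real t * w)) * (with_coord x a (of_real t * w)) $ a) = with_coord x a \<zeta>"
        using t False by (auto simp: vec_eq_iff)
      ultimately show "\<zeta> \<in> {\<zeta>. with_coord x a \<zeta> \<in> sibony_domain a b}" by simp
    qed
  qed
qed

lemma holomorphic_power_series_unit_disc:
  assumes c: "\<And>k. norm (c k :: complex) \<le> 1"
  obtains E where "E holomorphic_on ball 0 1" "\<And>w. w \<in> ball 0 1 \<Longrightarrow> (\<lambda>k. c k * w ^ k) sums E w"
    "\<And>w. w \<in> ball 0 1 \<Longrightarrow> norm (E w) \<le> 1 / (1 - norm w)"
proof -
  define E where "E w = (\<Sum>k. c k * w ^ k)" for w
  have n: "norm (c k * w ^ k) \<le> norm w ^ k" for k w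
    using c[of k] by (simp add: norm_mult norm_power mult_left_le_one_le)
  have s: "summable (\<lambda>k. norm (c k * w ^ k))" if "w \<in> ball 0 1" for w
    by (rule summable_comparison_test[of _ "\<lambda>k. norm w ^ k"]) (use n that in \<open>auto intro!: summable_geometric\<close>)
  have sums: "(\<lambda>k. c k * w ^ k) sums E w" if "w \<in> ball 0 1" for w
    unfolding E_def by (rule summable_sums) (rule summable_norm_cancel[OF s[OF that]])
  show ?thesis
  proof (rule that[of E])
    show "E holomorphic_on ball 0 1"
      by (rule power_series_holomorphic[where a = c]) (use sums in auto)
    show "norm (E w) \<le> 1 / (1 - norm w)" if "w \<in> ball 0 1" for w
    proof -
      have "norm (E w) \<le> (\<Sum>k. norm (c k * w ^ k))" unfolding E_def by (rule summable_norm[OF s[OF that]])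
      also have "\<dots> \<le> (\<Sum>k. norm w ^ k)"
        by (intro suminf_le n s[OF that] summable_geometric) (use that in auto)
      also have "\<dots> = 1 / (1 - norm w)" using that by (intro suminf_geometric) auto
      finally show ?thesis .
    qed
  qed (rule sums)
qed

text \<open>
  The Taylor coefficients at \<open>w = 0\<close> in the coordinate \<open>a\<close> are holomorphic in the coordinate \<open>b\<close>, and
  bounded, because all fibres contain the disc of radius \<open>1 / 32\<close>. Over a zero of a \<open>circle_factor\<close> the
  fibre is the whole unit disc, so there Cauchy's inequality bounds the coefficients by \<open>1\<close>. By
  \<open>dominating_root_circles\<close> they are bounded by \<open>1\<close> over the whole disc, and the Taylor series
  converges for \<open>\<bar>w\<bar> < 1\<close>.
\<close>
lemma slice_extension:
  fixes x :: "complex^'n"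
  assumes ab: "a \<noteq> b" and x: "x \<in> polydisc"
    and cont: "continuous_on (sibony_domain a b) f"
    and hol: "\<And>y i. (\<lambda>\<zeta>. f (with_coord y i \<zeta>)) holomorphic_on {\<zeta>. with_coord y i \<zeta> \<in> sibony_domain a b}"
    and bdd: "\<And>y. y \<in> sibony_domain a b \<Longrightarrow> norm (f y) \<le> (1::real)"
  obtains E where "E holomorphic_on ball 0 1"
    "\<And>w. with_coord x a w \<in> sibony_domain a b \<Longrightarrow> E w = f (with_coord x a w)"
    "\<And>w. w \<in> ball 0 1 \<Longrightarrow> norm (E w) \<le> 1 / (1 - norm w)"
proof -
  let ?D = "sibony_domain a b"
  define \<Phi> where "\<Phi> z w = f (with_coord (with_coord x b z) a w)" for z w
  have poly: "with_coord x b z \<in> polydisc" if "z \<in> ball 0 1" for z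
    using x that by (simp add: polydisc_def)
  have holw: "\<Phi> z holomorphic_on {w. with_coord (with_coord x b z) a w \<in> ?D}" for z
    unfolding \<Phi>_def by (rule hol)
  have swap: "with_coord (with_coord x b z) a w = with_coord (with_coord x a w) b z" for z w
    using ab by (auto simp: vec_eq_iff)
  have small: "with_coord (with_coord x b z) a w \<in> ?D" if "z \<in> ball 0 1" "w \<in> ball 0 (1/32)" for z w
    by (rule small_coord_in_sibony_domain[OF ab poly]) (use that in auto)
  have hw: "\<Phi> z holomorphic_on ball 0 (1/32)" if "z \<in> ball 0 1" for z
    by (rule holomorphic_on_subset[OF holw]) (use small that in auto)
  have coef_hol: "(\<lambda>z. (deriv ^^ k) (\<Phi> z) 0) holomorphic_on ball 0 1" for k
  proof (rule holomorphic_taylor_coefficient[of _ "1/32"])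
    have "continuous_on (ball 0 1 \<times> ball 0 (1/32)) (\<lambda>p. with_coord (with_coord x b (fst p)) a (snd p))"
      by (intro continuous_intros)
    then have "continuous_on (ball 0 1 \<times> ball 0 (1/32)) (\<lambda>p. f (with_coord (with_coord x b (fst p)) a (snd p)))"
      by (rule continuous_on_compose2[OF cont]) (use small in auto)
    then show "continuous_on (ball 0 1 \<times> ball 0 (1/32)) (\<lambda>(z, w). \<Phi> z w)"
      by (simp add: \<Phi>_def case_prod_unfold)
    show "(\<lambda>z. \<Phi> z w) holomorphic_on ball 0 1" if "w \<in> ball 0 (1/32)" for w
      unfolding \<Phi>_def swap
      by (rule holomorphic_on_subset[OF hol]) (use small that swap in auto)
  qed (use hw in auto)
  have coef: "norm ((deriv ^^ k) (\<Phi> z) 0 / fact k) \<le> 1" if "z \<in> ball 0 1" for z k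
  proof (rule dominating_root_circles[where g = "\<lambda>z. (deriv ^^ k) (\<Phi> z) 0 / fact k", OF _ _ _ that])
    show "(\<lambda>z. (deriv ^^ k) (\<Phi> z) 0 / fact k) holomorphic_on ball 0 1"
      by (intro holomorphic_intros coef_hol) auto
  next
    fix z :: complex assume z: "z \<in> ball 0 1"
    have "norm ((deriv ^^ k) (\<Phi> z) 0) \<le> fact k * 1 / (1/32) ^ k"
      by (rule deriv_at_centre_bound[OF hw[OF z]]) (use bdd small z in \<open>auto simp: \<Phi>_def\<close>)
    then have "norm ((deriv ^^ k) (\<Phi> z) 0) / fact k \<le> (fact k * 1 / (1/32) ^ k) / fact k"
      by (rule divide_right_mono) simp
    then show "norm ((deriv ^^ k) (\<Phi> z) 0 / fact k) \<le> 1 / (1/32) ^ k" by (simp add: norm_divide)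
  next
    fix z :: complex and m :: nat
    assume m: "0 < m" and z: "z \<in> ball 0 1" and root: "z ^ (m\<^sup>2) = of_real ((1/2) ^ m)"
    have full: "with_coord (with_coord x b z) a w \<in> ?D" if "w \<in> ball 0 1" for w
      using tower_eq_0[OF m root] x z that ab
      by (auto simp: sibony_domain_def polydisc_def intro!: exI[of _ m])
    have "norm ((deriv ^^ k) (\<Phi> z) 0) \<le> fact k * 1 / 1 ^ k"
      by (rule deriv_at_centre_bound) (use bdd full in \<open>auto simp: \<Phi>_def[of z] intro!: holomorphic_on_subset[OF holw]\<close>)
    then show "norm ((deriv ^^ k) (\<Phi> z) 0 / fact k) \<le> 1" by (simp add: norm_divide)
  qed
  have xb: "x $ b \<in> ball 0 1" using x by (simp add: polydisc_def)
  have \<Phi>x: "\<Phi> (x $ b) w = f (with_coord x a w)" for w by (simp add: \<Phi>_def)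
  define c where "c k = (deriv ^^ k) (\<Phi> (x $ b)) 0 / fact k" for k
  have "norm (c k) \<le> 1" for k unfolding c_def by (rule coef[OF xb])
  then obtain E where E: "E holomorphic_on ball 0 1"
    "\<And>w. w \<in> ball 0 1 \<Longrightarrow> (\<lambda>k. c k * w ^ k) sums E w"
    "\<And>w. w \<in> ball 0 1 \<Longrightarrow> norm (E w) \<le> 1 / (1 - norm w)"
    by (rule holomorphic_power_series_unit_disc[of c]) blast
  have "E w = f (with_coord x a w)" if w: "with_coord x a w \<in> ?D" for w
  proof -
    obtain R where R: "w \<in> ball 0 R" "ball 0 R \<subseteq> {\<zeta>. with_coord x a \<zeta> \<in> ?D}"
      by (rule fibre_contains_disc[OF ab x w])
    have "\<Phi> (x $ b) holomorphic_on ball 0 R"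
      by (rule holomorphic_on_subset[OF holw]) (use R in auto)
    then have "(\<lambda>k. c k * (w - 0) ^ k) sums \<Phi> (x $ b) w"
      unfolding c_def by (rule holomorphic_power_series[OF _ R(1)])
    moreover have "norm (with_coord x a w $ a) < 1"
      using w unfolding sibony_domain_def polydisc_def by blast
    then have "w \<in> ball 0 1" by simp
    ultimately show ?thesis using sums_unique2[OF E(2)[of w]] by (simp add: \<Phi>x)
  qed
  then show ?thesis by (rule that[OF E(1) _ E(3)])
qed

section \<open>Embeddings and the squeezing function\<close>

lemma complex_linear_imp_linear:
  assumes "complex_linear L"
  shows "linear L"
proof (rule linearI)
  show "L (x + y) = L x + L y" for x y using assms by (simp add: complex_linear_def)
  have scale: "r *\<^sub>R x = of_real r *s x" for r and x :: "complex^'k"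
    unfolding vec_eq_iff vector_scaleR_component vector_smult_component
    by (simp add: scaleR_conv_of_real)
  show "L (r *\<^sub>R x) = r *\<^sub>R L x" for r x
    using assms by (simp only: scale) (simp add: complex_linear_def)
qed

lemma holomorphic_map_on_imp_continuous_on:
  assumes "holomorphic_map_on F D"
  shows "continuous_on D F"
  using assms unfolding holomorphic_map_on_def
  by (meson continuous_at_imp_continuous_on has_derivative_continuous)

lemma has_derivative_curve:
  fixes E :: "complex \<Rightarrow> complex^'n"
  assumes "\<And>i. ((\<lambda>\<zeta>. E \<zeta> $ i) has_field_derivative v $ i) (at \<zeta>)"
  shows "(E has_derivative (\<lambda>h. h *s v)) (at \<zeta>)"
proof -
  have "((\<lambda>\<zeta>. \<Sum>i\<in>UNIV. (E \<zeta> $ i) *s axis i 1) has_derivative (\<lambda>h. \<Sum>i\<in>UNIV. (v $ i * h) *s axis i 1)) (at \<zeta>)"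
  proof (rule has_derivative_sum)
    fix i :: 'n
    have "bounded_linear (\<lambda>z::complex. z *s (axis i 1 :: complex^'n))"
      unfolding linear_conv_bounded_linear[symmetric]
      by (rule linearI) (auto simp: vec_eq_iff vector_scaleR_component algebra_simps)
    from bounded_linear.has_derivative[OF this assms[of i, THEN has_field_derivative_imp_has_derivative]]
    show "((\<lambda>\<zeta>. (E \<zeta> $ i) *s axis i 1) has_derivative (\<lambda>h. (v $ i * h) *s axis i 1)) (at \<zeta>)" .
  qed
  moreover have "(\<Sum>i\<in>UNIV. (u $ i) *s axis i 1) = u" for u :: "complex^'n"
    by (rule basis_expansion)
  moreover have "(\<Sum>i\<in>UNIV. (v $ i * h) *s axis i 1) = h *s v" for h
    using calculation(2)[of "h *s v"] by (simp add: mult.commute)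
  ultimately show ?thesis by simp
qed

lemma holomorphic_along_curve:
  fixes E :: "complex \<Rightarrow> complex^'n" and F :: "complex^'n \<Rightarrow> complex^'m"
  assumes E: "\<And>i. (\<lambda>\<zeta>. E \<zeta> $ i) holomorphic_on A" and "open A"
    and F: "\<And>\<zeta>. \<zeta> \<in> A \<Longrightarrow> \<exists>L. (F has_derivative L) (at (E \<zeta>)) \<and> complex_linear L"
  shows "(\<lambda>\<zeta>. F (E \<zeta>) $ j) holomorphic_on A"
  unfolding holomorphic_on_open[OF \<open>open A\<close>]
proof
  fix \<zeta> assume \<zeta>: "\<zeta> \<in> A"
  obtain L where L: "(F has_derivative L) (at (E \<zeta>))" "complex_linear L" using F[OF \<zeta>] by blast
  define v where "v = (\<chi> i. deriv (\<lambda>\<zeta>. E \<zeta> $ i) \<zeta>)"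
  have "(E has_derivative (\<lambda>h. h *s v)) (at \<zeta>)"
    by (rule has_derivative_curve) (simp add: v_def holomorphic_derivI[OF E \<open>open A\<close> \<zeta>])
  then have "((\<lambda>\<zeta>. F (E \<zeta>)) has_derivative (\<lambda>h. L (h *s v))) (at \<zeta>)"
    by (rule has_derivative_compose[of E _ \<zeta> UNIV F L, OF _ L(1)])
  from bounded_linear.has_derivative[OF bounded_linear_vec_nth this]
  have "((\<lambda>\<zeta>. F (E \<zeta>) $ j) has_derivative (\<lambda>h. L (h *s v) $ j)) (at \<zeta>)" .
  moreover have "(\<lambda>h. L (h *s v) $ j) = (*) (L v $ j)"
    using L(2) by (auto simp: complex_linear_def mult.commute)
  ultimately show "\<exists>f'. ((\<lambda>\<zeta>. F (E \<zeta>) $ j) has_field_derivative f') (at \<zeta>)"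
    by (auto simp: has_field_derivative_def)
qed

lemma inverse_complex_linear:
  fixes L :: "complex^'n \<Rightarrow> complex^'n"
  assumes L: "complex_linear L" "inj L"
  shows "bounded_linear (inv L)" "complex_linear (inv L)" "inv L \<circ> L = id"
proof -
  have lin: "linear L" by (rule complex_linear_imp_linear[OF L(1)])
  then have "bounded_linear L" by (simp only: linear_conv_bounded_linear)
  then show "bounded_linear (inv L)"
    using L(2) by (rule inj_linear_imp_inv_bounded_linear)
  show id: "inv L \<circ> L = id" using L(2) by simp
  have "surj L" using linear_inj_imp_surj[OF lin L(2)] .
  then have LL: "L (inv L y) = y" for y by (rule surj_f_inv_f)
  have "L (inv L (x + y)) = L (inv L x + inv L y)" "L (inv L (c *s x)) = L (c *s inv L x)" for x y c
    using L(1) by (simp_all add: LL complex_linear_def)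
  then show "complex_linear (inv L)"
    unfolding complex_linear_def using L(2) by (simp add: inj_eq)
qed

text \<open>
  The inverse function theorem, in the easy situation where a continuous inverse is given.
\<close>
lemma embedding_inverse_holomorphic:
  fixes F :: "complex^'n \<Rightarrow> complex^'n"
  assumes F: "holomorphic_embedding_on F D" and G: "homeomorphism D (F ` D) F G"
    and T: "open T" "T \<subseteq> F ` D"
  shows "holomorphic_map_on G T"
  unfolding holomorphic_map_on_def
proof
  fix y assume y: "y \<in> T"
  then have Gy: "G y \<in> D" using T G by (auto simp: homeomorphism_def)
  then obtain L where L: "(F has_derivative L) (at (G y))" "complex_linear L"
    using F by (auto simp: holomorphic_embedding_on_def holomorphic_map_on_def)
  have "inj L" using F Gy frechet_derivative_at[OF L(1)] by (auto simp: holomorphic_embedding_on_def)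
  note inverse = inverse_complex_linear[OF L(2) this]
  have "continuous_on T G"
    using G T by (auto simp: homeomorphism_def intro: continuous_on_subset)
  then have "isCont G y" using T y by (simp add: continuous_on_eq_continuous_at)
  moreover have "F (G z) = z" if "z \<in> T" for z using that T G by (auto simp: homeomorphism_def)
  ultimately have "(G has_derivative inv L) (at y)"
    using has_derivative_inverse_basic[of F L G y "inv L" T] L(1) inverse(1,3) T(1) y by blast
  then show "\<exists>L. (G has_derivative L) (at y) \<and> complex_linear L" using inverse by blast
qed

text \<open>
  Here \<open>P\<close> is a holomorphic disc, typically one in a complex line, and \<open>E\<close> extends \<open>F \<circ> P\<close> to the
  part of the disc that is not yet known to lie in \<open>D\<close>. With \<open>G\<close> the inverse of \<open>F\<close>, the map \<open>G \<circ> E\<close>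
  agrees with \<open>P\<close> near the centre, hence on the whole disc, and takes its values in \<open>D\<close>.
\<close>
lemma disc_in_embedded_domain:
  fixes F :: "complex^'n \<Rightarrow> complex^'n" and P E :: "complex \<Rightarrow> complex^'n"
  assumes F: "holomorphic_embedding_on F D" and D: "open D"
    and r: "ball 0 r \<subseteq> F ` D"
    and P: "\<And>i. (\<lambda>\<zeta>. P \<zeta> $ i) holomorphic_on ball c \<delta>" "continuous_on (ball c \<delta>) P" "P c \<in> D"
    and E: "\<And>i. (\<lambda>\<zeta>. E \<zeta> $ i) holomorphic_on ball c \<delta>"
      "\<And>\<zeta>. \<zeta> \<in> ball c \<delta> \<Longrightarrow> E \<zeta> \<in> ball 0 r"
      "\<And>\<zeta>. \<lbrakk>\<zeta> \<in> ball c \<delta>; P \<zeta> \<in> D\<rbrakk> \<Longrightarrow> E \<zeta> = F (P \<zeta>)"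
    and \<zeta>: "\<zeta> \<in> ball c \<delta>"
  shows "P \<zeta> \<in> D"
proof -
  obtain G where G: "homeomorphism D (F ` D) F G"
    using F by (auto simp: holomorphic_embedding_on_def)
  have hG: "holomorphic_map_on G (ball 0 r)"
    by (rule embedding_inverse_holomorphic[OF F G open_ball r])
  have GF: "G (F y) = y" if "y \<in> D" for y using that G by (auto simp: homeomorphism_def)
  have "0 < \<delta>" using \<zeta> by (metis ball_eq_empty empty_iff not_le)
  define V where "V = {\<zeta> \<in> ball c \<delta>. P \<zeta> \<in> D}"
  have "open V"
    unfolding V_def using continuous_open_preimage[OF P(2) open_ball D] by (simp add: vimage_def Int_def)
  moreover have "c \<in> V" using P \<open>0 < \<delta>\<close> by (simp add: V_def)
  ultimately have lim: "c islimpt V" by (rule interior_limit_point[OF interior_open[THEN equalityD2, THEN subsetD]])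
  have "G (E \<zeta>) $ j - P \<zeta> $ j = 0" for j
  proof (rule analytic_continuation[of "\<lambda>\<zeta>. G (E \<zeta>) $ j - P \<zeta> $ j" "ball c \<delta>" V c])
    have "(\<lambda>\<zeta>. G (E \<zeta>) $ j) holomorphic_on ball c \<delta>"
      by (rule holomorphic_along_curve[OF E(1) open_ball])
        (use hG E(2) in \<open>auto simp: holomorphic_map_on_def\<close>)
    then show "(\<lambda>\<zeta>. G (E \<zeta>) $ j - P \<zeta> $ j) holomorphic_on ball c \<delta>"
      by (intro holomorphic_intros P)
    show "G (E z) $ j - P z $ j = 0" if "z \<in> V" for z
      using that E(3)[of z] GF[of "P z"] by (simp add: V_def)
  qed (use \<zeta> lim \<open>0 < \<delta>\<close> in \<open>auto simp: V_def\<close>)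
  then have "G (E \<zeta>) = P \<zeta>" by (simp add: vec_eq_iff)
  moreover have "G (E \<zeta>) \<in> D" using E(2)[OF \<zeta>] r G by (auto simp: homeomorphism_def)
  ultimately show ?thesis by simp
qed

lemma affine_embedding_exists:
  fixes D :: "(complex^'n) set"
  assumes "bounded D" 
  obtains F :: "complex^'n \<Rightarrow> complex^'n"
  where "holomorphic_embedding_on F D" "F ` D \<subseteq> ball 0 1" "F z = 0"
proof -
  obtain C where C: "0 < C" "\<And>y. y \<in> D \<Longrightarrow> norm (y - z) < C"
  proof -
    obtain B where "\<And>y. y \<in> D \<Longrightarrow> norm y \<le> B" using assms by (auto simp: bounded_iff)
    moreover have "norm (y - z) \<le> norm y + norm z" for y by (rule norm_triangle_ineq4)
    ultimately have "\<And>y. y \<in> D \<Longrightarrow> norm (y - z) < \<bar>B\<bar> + norm z + 1"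
      by (smt (verit, best))
    then show ?thesis by (intro that[of "\<bar>B\<bar> + norm z + 1"]) (auto intro: add_nonneg_pos)
  qed
  define F where "F y = (1 / C) *\<^sub>R (y - z)" for y
  have der: "(F has_derivative (\<lambda>h. (1 / C) *\<^sub>R h)) (at y)" for y
    unfolding F_def by (auto intro!: derivative_eq_intros)
  have lin: "complex_linear (\<lambda>h :: complex^'n. (1 / C) *\<^sub>R h)"
    by (auto simp: complex_linear_def vec_eq_iff vector_scaleR_component scaleR_right_distrib)
  have "inj (\<lambda>h :: complex^'n. (1 / C) *\<^sub>R h)" using C by (auto simp: inj_on_def)
  then have inj: "inj (frechet_derivative F (at y))" for y
    using frechet_derivative_at[OF der[of y]] by simp
  have "homeomorphism D (F ` D) F (\<lambda>y. C *\<^sub>R y + z)"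
    unfolding homeomorphism_def F_def using C by (auto intro!: continuous_intros simp: image_image)
  then have "holomorphic_embedding_on F D"
    unfolding holomorphic_embedding_on_def holomorphic_map_on_def using der lin inj by blast
  moreover have "F ` D \<subseteq> ball 0 1" using C by (auto simp: F_def)
  ultimately show ?thesis by (rule that) (simp add: F_def)
qed

text \<open>
  The suprema in the definition of the squeezing function are suprema of non-empty sets: images of
  embeddings are open by invariance of domain, and a scaled translation is an admissible embedding.
\<close>
lemma squeezing_bounds:
  fixes D :: "(complex^'n) set"
  assumes D: "open D" "bounded D" and z: "z \<in> D"
    and e: "\<And>(F :: complex^'n \<Rightarrow> complex^'n) r. \<lbrakk>holomorphic_embedding_on F D; F ` D \<subseteq> ball 0 1; F z = 0; 0 < r; ball 0 r \<subseteq> F ` D\<rbrakk> \<Longrightarrow> r \<le> \<epsilon>"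
  shows "0 \<le> squeezing D z" "squeezing D z \<le> \<epsilon>"
proof -
  let ?A = "{F :: complex^'n \<Rightarrow> complex^'n. holomorphic_embedding_on F D \<and> F ` D \<subseteq> ball 0 1 \<and> F z = 0}"
  have bounds: "0 \<le> squeezing_via D F \<and> squeezing_via D F \<le> \<epsilon>" if F: "F \<in> ?A" for F
  proof -
    let ?R = "{r. r > 0 \<and> ball 0 r \<subseteq> F ` D}"
    have "open (F ` D)"
      using F D(1) holomorphic_map_on_imp_continuous_on
      by (intro invariance_of_domain) (auto simp: holomorphic_embedding_on_def homeomorphism_def intro: inj_on_inverseI)
    moreover have "0 \<in> F ` D" using F z by force
    ultimately obtain r where r: "r \<in> ?R" unfolding open_contains_ball by blast
    have le: "s \<le> \<epsilon>" if "s \<in> ?R" for s using e[of F s] F that by auto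
    then have "squeezing_via D F \<le> \<epsilon>"
      unfolding squeezing_via_def using r by (intro cSup_least) auto
    moreover have "r \<le> squeezing_via D F"
      unfolding squeezing_via_def using r le by (intro cSup_upper bdd_aboveI) auto
    ultimately show ?thesis using r by auto
  qed
  obtain F where F: "F \<in> ?A" by (rule affine_embedding_exists[OF D(2), of z]) blast
  have eq: "squeezing D z = Sup (squeezing_via D ` ?A)"
    unfolding squeezing_def by (rule arg_cong[where f = Sup]) auto
  show "squeezing D z \<le> \<epsilon>" unfolding eq using F bounds by (intro cSup_least) auto
  have "squeezing_via D F \<le> squeezing D z"
    unfolding eq using F bounds by (intro cSup_upper bdd_aboveI) auto
  then show "0 \<le> squeezing D z" using bounds[OF F] by linarith
qed

section \<open>Behaviour at the boundary\<close>

lemma slice_extension_of_map: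
  fixes F :: "complex^'n \<Rightarrow> complex^'m"
  assumes ab: "a \<noteq> b" and x: "x \<in> polydisc"
    and F: "holomorphic_map_on F (sibony_domain a b)" "F ` sibony_domain a b \<subseteq> ball 0 1"
  obtains E where "\<And>i. E i holomorphic_on ball 0 1"
    "\<And>i w. with_coord x a w \<in> sibony_domain a b \<Longrightarrow> E i w = F (with_coord x a w) $ i"
    "\<And>i w. w \<in> ball 0 1 \<Longrightarrow> norm (E i w) \<le> 1 / (1 - norm w)"
proof -
  let ?D = "sibony_domain a b"
  let ?P = "\<lambda>i E. E holomorphic_on ball 0 1
    \<and> (\<forall>w. with_coord x a w \<in> ?D \<longrightarrow> E w = F (with_coord x a w) $ i)
    \<and> (\<forall>w. w \<in> ball 0 1 \<longrightarrow> norm (E w) \<le> 1 / (1 - norm w))"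
  have ex: "\<exists>E. ?P i E" for i
  proof -
    have cont: "continuous_on ?D (\<lambda>y. F y $ i)"
      using holomorphic_map_on_imp_continuous_on[OF F(1)] by (intro continuous_intros)
    have hol: "(\<lambda>\<zeta>. F (with_coord y j \<zeta>) $ i) holomorphic_on {\<zeta>. with_coord y j \<zeta> \<in> ?D}" for y j
    proof (rule holomorphic_along_curve[where E = "with_coord y j" and F = F])
      show "open {\<zeta>. with_coord y j \<zeta> \<in> ?D}"
        using open_vimage[OF open_sibony_domain[of a b], of "with_coord y j"]
        by (simp add: vimage_def continuous_on_with_coord)
      show "(\<lambda>\<zeta>. with_coord y j \<zeta> $ k) holomorphic_on {\<zeta>. with_coord y j \<zeta> \<in> ?D}" for k
        by (cases "k = j") (auto intro!: holomorphic_intros)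
      show "\<exists>L. (F has_derivative L) (at (with_coord y j \<zeta>)) \<and> complex_linear L"
        if "\<zeta> \<in> {\<zeta>. with_coord y j \<zeta> \<in> ?D}" for \<zeta>
        using that F(1) by (simp add: holomorphic_map_on_def)
    qed
    have bdd: "norm (F y $ i) \<le> 1" if "y \<in> ?D" for y
    proof -
      have "norm (F y) < 1" using F(2) that by (simp add: image_subset_iff)
      then show ?thesis using Finite_Cartesian_Product.norm_nth_le[of "F y" i] by linarith
    qed
    show ?thesis
    proof (rule slice_extension[OF ab x cont hol bdd])
      fix E
      assume E: "E holomorphic_on ball 0 1"
        "\<And>w. with_coord x a w \<in> ?D \<Longrightarrow> E w = F (with_coord x a w) $ i"
        "\<And>w. w \<in> ball 0 1 \<Longrightarrow> norm (E w) \<le> 1 / (1 - norm w)"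
      show ?thesis by (intro exI[of _ E] conjI allI impI E)
    qed
  qed
  have "\<exists>E. \<forall>i. ?P i (E i)" by (rule choice) (rule allI, rule ex)
  then obtain E where E: "\<forall>i. ?P i (E i)" by (rule exE)
  show ?thesis
  proof (rule that[of E])
    show "E i holomorphic_on ball 0 1" for i using E[rule_format, of i] by (rule conjunct1)
    show "E i w = F (with_coord x a w) $ i" if "with_coord x a w \<in> ?D" for i w
      using E[rule_format, of i, THEN conjunct2, THEN conjunct1] that by (elim allE impE)
    show "norm (E i w) \<le> 1 / (1 - norm w)" if "w \<in> ball 0 1" for i w
      using E[rule_format, of i, THEN conjunct2, THEN conjunct2] that by (elim allE impE)
  qed
qed

text \<open>
  An admissible \<open>F\<close> at \<open>x\<close> extends along the slice through \<open>x\<close> in the coordinate \<open>a\<close>, with Lipschitz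
  constant \<open>L\<close> near \<open>x\<close> depending on \<open>p\<close> only. If its image contained a ball of radius greater than
  \<open>\<epsilon>\<close>, the slice disc about \<open>x\<close> of radius \<open>\<epsilon> / L\<close> would lie in the domain; but for \<open>x\<close> near \<open>p\<close> it meets
  the exterior.
\<close>
lemma squeezing_tendsto_0_at_vertical_boundary:
  fixes a b :: "'n::finite"
  assumes ab: "a \<noteq> b" and p: "p \<in> polydisc" "p \<notin> sibony_domain a b"
  shows "(squeezing (sibony_domain a b) \<longlongrightarrow> 0) (at p within sibony_domain a b)"
proof (rule tendstoI)
  fix e :: real assume "0 < e"
  let ?D = "sibony_domain a b"
  define \<epsilon> where "\<epsilon> = e / 2"
  \<comment> \<open>The disc of radius \<open>3 * s\<close> about \<open>p $ a\<close> keeps distance \<open>5 * s\<close> from the unit circle; there the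
    extensions are bounded by \<open>1 / (5 * s)\<close>.\<close>
  define s where "s = (1 - norm (p $ a)) / 8"
  \<comment> \<open>A Lipschitz constant for the sum of the norms of all components, by Cauchy's inequality on discs of
    radius \<open>s\<close>.\<close>
  define L where "L = real CARD('n) * (1 / (5 * s) / s)"
  define \<delta> where "\<delta> = min s (\<epsilon> / L)"
  \<comment> \<open>Moves \<open>p\<close> into the exterior by less than \<open>\<delta> / 2\<close>.\<close>
  define c where "c = 1 + \<delta> / (2 * (norm (p $ a) + 1))"
  have "0 < \<epsilon>" using \<open>0 < e\<close> by (simp add: \<epsilon>_def)
  have "0 < s" using p by (auto simp: s_def polydisc_def)
  have "0 < L" using \<open>0 < s\<close> by (auto simp: L_def)
  have \<delta>: "0 < \<delta>" "\<delta> \<le> s" "L * \<delta> \<le> \<epsilon>"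
    using \<open>0 < s\<close> \<open>0 < L\<close> \<open>0 < \<epsilon>\<close> by (auto simp: \<delta>_def min_def field_simps)
  have "0 < norm (p $ a) + 1" by (simp add: add_nonneg_pos)
  then have "1 < c" "(c - 1) * norm (p $ a) < \<delta> / 2"
    using \<delta> by (auto simp: c_def field_simps)
  then have cp: "norm (of_real c * p $ a - p $ a) < \<delta> / 2"
  proof -
    have "of_real c * p $ a - p $ a = of_real (c - 1) * p $ a" by (simp add: algebra_simps)
    then have "norm (of_real c * p $ a - p $ a) = (c - 1) * norm (p $ a)"
      using \<open>1 < c\<close> by (simp only: norm_mult norm_of_real)
    then show ?thesis using \<open>(c - 1) * norm (p $ a) < \<delta> / 2\<close> by simp
  qed
  obtain U where U: "open U" "with_coord p a (of_real c * p $ a) \<in> U" "U \<inter> ?D = {}"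
    by (rule exterior_of_sibony_domain[OF ab p \<open>1 < c\<close>])
  define V where "V = (\<lambda>x. with_coord x a (of_real c * p $ a)) -` U \<inter> {x. norm (x $ a - p $ a) < \<delta> / 2}"
  have "open V" unfolding V_def
    by (intro open_Int open_vimage[OF U(1)] open_Collect_less continuous_intros)
  moreover have "p \<in> V" using U(2) \<delta> by (simp add: V_def)
  moreover have "dist (squeezing ?D x) 0 < e" if x: "x \<in> V" "x \<in> ?D" for x
  proof -
    have small: "r \<le> \<epsilon>" if F: "holomorphic_embedding_on F ?D" "F ` ?D \<subseteq> ball 0 1" "F x = 0"
      and r: "0 < r" "ball 0 r \<subseteq> F ` ?D" for F :: "complex^'n \<Rightarrow> complex^'n" and r
    proof (rule ccontr)
      assume "\<not> r \<le> \<epsilon>"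
      have F': "holomorphic_map_on F ?D" using F(1) by (simp add: holomorphic_embedding_on_def)
      have "x \<in> polydisc" using x by (simp add: sibony_domain_def)
      obtain E where E: "\<And>i. E i holomorphic_on ball 0 1"
          "\<And>i w. with_coord x a w \<in> ?D \<Longrightarrow> E i w = F (with_coord x a w) $ i"
          "\<And>i w. w \<in> ball 0 1 \<Longrightarrow> norm (E i w) \<le> 1 / (1 - norm w)"
        by (rule slice_extension_of_map[OF ab \<open>x \<in> polydisc\<close> F' F(2)]) blast
      have norm_disc: "norm w < 1 - 5 * s" if "w \<in> ball (x $ a) (2 * s)" for w
      proof -
        have "norm w \<le> norm (w - x $ a) + norm (x $ a - p $ a) + norm (p $ a)"
          using norm_triangle_ineq[of "w - x $ a" "x $ a"] norm_triangle_ineq[of "x $ a - p $ a" "p $ a"] by simp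
        moreover have "norm (x $ a - p $ a) < s" using x(1) \<delta> by (simp add: V_def)
        moreover have "norm (w - x $ a) < 2 * s" using that by (simp add: dist_norm norm_minus_commute)
        moreover have "8 * s = 1 - norm (p $ a)" by (simp add: s_def)
        ultimately show ?thesis by linarith
      qed
      then have sub: "ball (x $ a) (2 * s) \<subseteq> ball 0 1" using \<open>0 < s\<close> by fastforce
      have lip: "norm (E i w - E i (x $ a)) \<le> 1 / (5 * s) / s * norm (w - x $ a)"
        if "w \<in> ball (x $ a) s" for i w
      proof (rule lipschitz_inside_ball[where r = "2 * s"])
        show "E i holomorphic_on ball (x $ a) (2 * s)" by (rule holomorphic_on_subset[OF E(1) sub])
        show "norm (E i v) \<le> 1 / (5 * s)" if "v \<in> ball (x $ a) (s + s)" for v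
        proof -
          have "norm (E i v) \<le> 1 / (1 - norm v)" using E(3) sub that by auto
          also have "\<dots> \<le> 1 / (5 * s)"
            using norm_disc[of v] that \<open>0 < s\<close> by (intro divide_left_mono) auto
          finally show ?thesis .
        qed
      qed (use that \<open>0 < s\<close> in auto)
      have E0: "E i (x $ a) = 0" for i using E(2)[of "x $ a" i] x F(3) by simp
      define E' where "E' \<zeta> = (\<chi> i. E i \<zeta>)" for \<zeta>
      have inD: "with_coord x a \<zeta> \<in> ?D" if \<zeta>: "\<zeta> \<in> ball (x $ a) \<delta>" for \<zeta>
      proof (rule disc_in_embedded_domain[OF F(1) open_sibony_domain r(2) _ _ _ _ _ _ \<zeta>])
        show "(\<lambda>\<zeta>. with_coord x a \<zeta> $ i) holomorphic_on ball (x $ a) \<delta>" for i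
          by (cases "i = a") (auto intro!: holomorphic_intros)
        show "continuous_on (ball (x $ a) \<delta>) (with_coord x a)" by (intro continuous_intros)
        show "with_coord x a (x $ a) \<in> ?D" using x by simp
        have "ball (x $ a) \<delta> \<subseteq> ball 0 1" using sub \<delta> \<open>0 < s\<close> by (auto simp: subset_iff)
        then show "(\<lambda>\<zeta>. E' \<zeta> $ i) holomorphic_on ball (x $ a) \<delta>" for i
          using holomorphic_on_subset[OF E(1)] by (simp add: E'_def)
        show "E' w = F (with_coord x a w)" if "with_coord x a w \<in> ?D" for w
          using E(2)[OF that] by (simp add: E'_def vec_eq_iff)
        show "E' w \<in> ball 0 r" if w: "w \<in> ball (x $ a) \<delta>" for w
        proof -
          have "norm (E' w) \<le> (\<Sum>i\<in>UNIV. norm (E i w))"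
            unfolding norm_vec_def E'_def using L2_set_le_sum[of UNIV "\<lambda>i. norm (E i w)"] by simp
          also have "\<dots> \<le> (\<Sum>i\<in>(UNIV::'n set). 1 / (5 * s) / s * norm (w - x $ a))"
            using lip w \<delta> E0 by (intro sum_mono) fastforce
          also have "\<dots> = L * norm (w - x $ a)" by (simp add: L_def)
          also have "\<dots> \<le> L * \<delta>"
            using w \<open>0 < L\<close> by (intro mult_left_mono) (auto simp: dist_norm norm_minus_commute)
          also have "\<dots> < r" using \<delta> \<open>\<not> r \<le> \<epsilon>\<close> by simp
          finally show ?thesis by simp
        qed
      qed
      have "norm (of_real c * p $ a - x $ a) < \<delta>"
        using cp x(1) norm_triangle_ineq[of "of_real c * p $ a - p $ a" "p $ a - x $ a"]
        by (simp add: V_def norm_minus_commute)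
      then have "with_coord x a (of_real c * p $ a) \<in> ?D"
        by (intro inD) (simp add: dist_norm norm_minus_commute)
      then show False using U(3) x(1) by (auto simp: V_def)
    qed
    have "bounded ?D" by (rule bounded_subset[OF bounded_polydisc]) (auto simp: sibony_domain_def)
    note bounds = squeezing_bounds[where \<epsilon> = \<epsilon>, OF open_sibony_domain this x(2)]
    have "0 \<le> squeezing ?D x" by (rule bounds(1)) (rule small)
    moreover have "squeezing ?D x \<le> \<epsilon>" by (rule bounds(2)) (rule small)
    ultimately show ?thesis using \<open>0 < e\<close> by (simp add: \<epsilon>_def dist_real_def)
  qed
  ultimately show "\<forall>\<^sub>F x in at p within ?D. dist (squeezing ?D x) 0 < e"
    unfolding eventually_at_topological by blast
qed

lemma interior_frontier_open:
  assumes "open S"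
  shows "interior (frontier S) = {}"
proof -
  have "interior (frontier S) \<inter> S = {}"
    using assms interior_subset[of "frontier S"] by (auto simp: frontier_def interior_open)
  then have "interior (frontier S) \<inter> closure S = {}"
    by (simp add: open_Int_closure_eq_empty)
  then show ?thesis using interior_subset[of "frontier S"] by (auto simp: frontier_def)
qed

text \<open>
  In a small ball about \<open>q\<close> the frontier separates the points of \<open>D\<close> from those off \<open>closure D\<close>.
\<close>
lemma locally_separating_at_frontier:
  fixes D :: "(complex^'n) set"
  assumes D: "open D" and N: "open N" and q: "q \<in> frontier D" "q \<in> N"
    and ext: "\<And>U. \<lbrakk>open U; q \<in> U\<rbrakk> \<Longrightarrow> \<not> U \<subseteq> closure D"
  shows "locally_separating_at (frontier D \<inter> N) q"
  unfolding locally_separating_at_def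
proof (intro conjI)
  have "closure (frontier D \<inter> N) \<subseteq> frontier D" by (rule closure_minimal) auto
  then have "interior (closure (frontier D \<inter> N)) \<subseteq> interior (frontier D)" by (rule interior_mono)
  then show "nowhere_dense (frontier D \<inter> N)"
    unfolding nowhere_dense_def interior_frontier_open[OF D] by blast
  show "q \<in> frontier D \<inter> N" using q by simp
  obtain r where r: "0 < r" "ball q r \<subseteq> N" using N q open_contains_ball by blast
  let ?B = "ball q r - frontier D \<inter> N"
  have B: "?B = ball q r \<inter> D \<union> (ball q r - closure D)"
    using r D by (auto simp: frontier_def interior_open closure_subset[THEN subsetD])
  have "q \<in> closure D" using q by (simp add: frontier_def)
  then obtain y where y: "y \<in> D" "y \<in> ball q r"
    using \<open>0 < r\<close> by (meson closure_approachable mem_ball dist_commute_lessI)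
  have "\<not> ball q r \<subseteq> closure D" by (rule ext) (use \<open>0 < r\<close> in auto)
  then obtain z where z: "z \<in> ball q r" "z \<notin> closure D" by blast
  have yz: "y \<in> ?B" "z \<in> ?B" using y z B by auto
  have "\<not> connected_component ?B y z"
  proof
    assume "connected_component ?B y z"
    then obtain T where T: "connected T" "T \<subseteq> ?B" "y \<in> T" "z \<in> T" by (auto simp: connected_component_def)
    have "D \<inter> T = {} \<or> (- closure D) \<inter> T = {}"
      by (rule connectedD[OF T(1) D open_Compl[OF closed_closure]])
        (use T(2) B closure_subset[of D] in auto)
    then show False using T y z by auto
  qed
  then have "connected_component_set ?B y \<noteq> connected_component_set ?B z"
    using yz by (simp add: connected_component_eq_eq)
  moreover have "connected_component_set ?B y \<in> components ?B" "connected_component_set ?B z \<in> components ?B"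
    using yz by (auto intro: componentsI)
  ultimately have "\<exists>C1\<in>components ?B. \<exists>C2\<in>components ?B. C1 \<noteq> C2"
    by (intro bexI[of _ "connected_component_set ?B y"] bexI[of _ "connected_component_set ?B z"])
  then show "\<exists>r>0. \<exists>C1\<in>components (ball q r - frontier D \<inter> N). \<exists>C2\<in>components (ball q r - frontier D \<inter> N). C1 \<noteq> C2"
    using \<open>0 < r\<close> by (intro exI[of _ r] conjI)
qed

lemma boundary_of_sibony_domain_has_exterior:
  fixes a b :: "'n::finite"
  assumes ab: "a \<noteq> b" and q: "q \<in> polydisc" "q \<notin> sibony_domain a b" and W: "open W" "q \<in> W"
  shows "\<not> W \<subseteq> closure (sibony_domain a b)"
proof -
  have "((\<lambda>c::real. with_coord q a (of_real c * q $ a)) \<longlongrightarrow> with_coord q a (of_real 1 * q $ a)) (at_right 1)"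
  proof -
    have "continuous_on UNIV (\<lambda>c::real. with_coord q a (of_real c * q $ a))"
      by (intro continuous_intros)
    then have "isCont (\<lambda>c::real. with_coord q a (of_real c * q $ a)) 1"
      by (simp add: continuous_on_eq_continuous_at)
    then show ?thesis unfolding isCont_def by (rule tendsto_within_subset) simp
  qed
  then have "\<forall>\<^sub>F c in at_right (1::real). with_coord q a (of_real c * q $ a) \<in> W"
    using W by (intro topological_tendstoD) auto
  moreover have "\<forall>\<^sub>F c in at_right (1::real). 1 < c" by (rule eventually_at_right_less)
  ultimately have "\<forall>\<^sub>F c in at_right (1::real). 1 < c \<and> with_coord q a (of_real c * q $ a) \<in> W"
    by eventually_elim simp
  then obtain c :: real where c: "1 < c" "with_coord q a (of_real c * q $ a) \<in> W"
    using eventually_happens'[OF trivial_limit_at_right_real] by blast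
  obtain U where U: "open U" "with_coord q a (of_real c * q $ a) \<in> U" "U \<inter> sibony_domain a b = {}"
    by (rule exterior_of_sibony_domain[OF ab q c(1)])
  then have "U \<inter> closure (sibony_domain a b) = {}" by (simp add: open_Int_closure_eq_empty)
  then show ?thesis using U(2) c(2) by blast
qed

theorem corollary1p13:
  assumes "CARD('n::finite) \<ge> 2"
  shows "\<exists>(D :: (complex^'n) set) \<omega>.
           domain_in D \<and> bounded D \<and> pseudoconvex D \<and>
           \<omega> \<noteq> {} \<and> openin (top_of_set (frontier D)) \<omega> \<and>
           (\<exists>q\<in>\<omega>. locally_separating_at \<omega> q) \<and>
           (\<forall>p\<in>\<omega>. (squeezing D \<longlongrightarrow> 0) (at p within D))"
proof -
  obtain a b :: 'n where ab: "a \<noteq> b"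
  proof -
    have "\<not> card (UNIV :: 'n set) \<le> Suc 0" using assms by simp
    then show ?thesis using that by (auto simp: card_le_Suc0_iff_eq)
  qed
  define D where "D = sibony_domain a b"
  define \<omega> where "\<omega> = frontier D \<inter> polydisc"
  have "open D" unfolding D_def by (rule open_sibony_domain)
  have sub: "D \<subseteq> polydisc" by (auto simp: D_def sibony_domain_def)
  have notin: "q \<notin> D" if "q \<in> \<omega>" for q
    using that \<open>open D\<close> by (auto simp: \<omega>_def frontier_def interior_open)
  \<comment> \<open>The segment from \<open>0\<close> to \<open>y\<close> leaves the domain inside the polydisc, so \<open>\<omega>\<close> is not empty.\<close>
  define y :: "complex^'n" where "y = with_coord 0 a (1/2)"
  have y: "y \<in> polydisc" by (simp add: y_def polydisc_def)
  have "y \<notin> D"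
    using tower_at_0[of "1/2"] ab by (auto simp: y_def D_def sibony_domain_def not_less)
  have "0 \<in> D"
    using small_coord_in_sibony_domain[OF ab, of 0 0] with_coord_same[of 0 a]
    by (simp add: D_def polydisc_def)
  have "\<omega> \<noteq> {}"
  proof -
    have "polydisc \<inter> frontier D \<noteq> {}"
      by (rule connected_Int_frontier[OF convex_connected[OF convex_polydisc]])
        (use y \<open>y \<notin> D\<close> \<open>0 \<in> D\<close> sub in auto)
    then show ?thesis by (simp add: \<omega>_def Int_commute)
  qed
  then obtain q where q: "q \<in> \<omega>" by blast
  have "locally_separating_at \<omega> q"
    unfolding \<omega>_def
    by (rule locally_separating_at_frontier[OF \<open>open D\<close> open_polydisc])
      (use q notin[OF q] boundary_of_sibony_domain_has_exterior[OF ab, of q] in \<open>auto simp: \<omega>_def D_def\<close>)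
  moreover have "openin (top_of_set (frontier D)) \<omega>"
    unfolding \<omega>_def by (rule openin_open_Int[OF open_polydisc])
  moreover have "(squeezing D \<longlongrightarrow> 0) (at p within D)" if "p \<in> \<omega>" for p
    using squeezing_tendsto_0_at_vertical_boundary[OF ab, of p] that notin[OF that] by (simp add: \<omega>_def D_def)
  moreover have "domain_in D"
    using \<open>open D\<close> \<open>0 \<in> D\<close> connected_sibony_domain[OF ab] by (auto simp: domain_in_def D_def)
  moreover have "bounded D" using bounded_polydisc sub by (rule bounded_subset)
  moreover have "pseudoconvex D" unfolding D_def by (rule pseudoconvex_sibony_domain)
  ultimately show ?thesis using \<open>\<omega> \<noteq> {}\<close> q by blast
qed

end
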